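(* There exists an isomorphism of categories $$\Phi:\mathbf{Cross}\to Ho\mathbf{Grstr},$$ given on objects by $(B\to D)\mapsto \mathbb P_{B\to D}$ and on morphisms by $(f_1,f_0)\mapsto [F]$, where $F$ is given by $F(x)=f_0(x)$ for $x\in \mathrm{Ob}(\mathbb P_{B\to D})$ and $F(b)=f_1(b)$ for $b\in\mathrm{Mor}(\mathbb P_{B\to D})$.
   Context: **Crossed modules.** A crossed module is a quadruple $(B,D,d,\theta)$, also written $B\xrightarrow{d}D$ or $B\to D$, where $d:B\to D$ and $\theta:D\to\mathrm{Aut}(B)$ are group homomorphisms with $\theta\circ d=\mu$ (where $\mu_b$ is conjugation by $b$ on $B$) and $d(\theta_x(b))=x\,d(b)\,x^{-1}$ for $x\in D$, $b\in B$. The group $B$ (not necessarily abelian) is written additively, $D$ multiplicatively. A morphism $(f_1,f_0):(B,D,d,\theta)\to(B',D',d',\theta')$ consists of group homomorphisms $f_1:B\to B'$, $f_0:D\to D'$ with $f_0d=d'f_1$ and $f_1(\theta_xb)=\theta'_{f_0(x)}f_1(b)$ for all $x\in D,b\in B$. $\mathbf{Cross}$ is the category of crossed modules and these morphisms. **Strict Gr-categories and Gr-functors.** A Gr-category is a monoidal category in which every morphism is invertible and every object $x$ has a weak inverse $y$ ($x\otimes y$ and $y\otimes x$ are isomorphic to the unit object). A strict Gr-category is a strict monoidal category in which every morphism is invertible and every object $x$ has a strict inverse ($x\otimes y=y\otimes x=1$). A Gr-functor $(F,\widetilde F)$ between Gr-categories is a monoidal functor $(F,\widetilde F,F_\ast)$,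 with natural isomorphisms $\widetilde F_{x,y}:Fx\otimes Fy\to F(x\otimes y)$ and an isomorphism $F_\ast:I'\to FI$ satisfying the usual coherence conditions ($F_\ast$ is determined by $F$ and $\widetilde F$, so it is omitted). Two Gr-functors are homotopic if there is a monoidal natural isomorphism between them (compatible with $\widetilde F$ and with $F_\ast$). **The Gr-category of a crossed module.** For a crossed module $(B,D,d,\theta)$, the associated strict Gr-category $\mathbb P=\mathbb P_{B\to D}$ has $\mathrm{Ob}(\mathbb P)=D$, $\mathrm{Hom}(x,y)=\{b\in B: x=d(b)y\}$, composition $(x\xrightarrow{b}y\xrightarrow{c}z)=(x\xrightarrow{b+c}z)$, tensor product on objects the multiplication of $D$, and on morphisms $(x\xrightarrow{b}y)\otimes(x'\xrightarrow{b'}y')=(xx'\xrightarrow{b+\theta_y b'}yy')$; the constraints are identities. **The crossed module of a strict Gr-category.** Conversely, a strict Gr-category $\mathbb P$ has an associated crossed module $C_{\mathbb P}=(B,D,d,\theta)$: $D=\mathrm{Ob}(\mathbb P)$ with $xy=x\otimes y$; $B$ is the set of morphisms $x\xrightarrow{b}1$ ($x\in D$) with $b+c=b\otimes c$; $d(x\xrightarrow{b}1)=x$; and $\theta_y(x\xrightarrow{b}1)=(yxy^{-1}\xrightarrow{id_y\otimes b\otimes id_{y^{-1}}}1)$. Strict Gr-categories are identified with crossed modules by these constructions: $\mathbb P$ is identified with $\mathbb P_{C_{\mathbb P}}$ (a morphism $x\xrightarrow{b}y$ of $\mathbb P_{C_{\mathbb P}}$, with $b:xy^{-1}\to 1$,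 corresponding to $b\otimes id_y:x\to y$ in $\mathbb P$), and $C_{\mathbb P_{B\to D}}$ with $B\to D$. **The category $Ho\mathbf{Grstr}$.** A Gr-functor $(F,\widetilde F):\mathbb P\to\mathbb P'$ between strict Gr-categories (written as Gr-categories associated to crossed modules $(B,D,d,\theta)$ and $(B',D',d',\theta')$) is single if there is $\widetilde c\in\mathrm{Aut}(1')=\mathrm{Ker}\,d'$ such that $\widetilde F_{x,y}=\widetilde c$ (as elements of $B'$) for all objects $x,y$ of $\mathbb P$. $\mathbf{Grstr}$ is the category of strict Gr-categories and single Gr-functors. Two Gr-functors $(F,\widetilde F)$, $(G,\widetilde G)$ are strong homotopic if they are homotopic and $F=G$. $Ho\mathbf{Grstr}$ is the quotient category with the same objects as $\mathbf{Grstr}$ and with morphisms the strong homotopy classes $[F]$ of single Gr-functors. In the claim, $[F]$ denotes the strong homotopy class of single Gr-functors $(F,\widetilde F)$ whose underlying functor is the stated $F$. *)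

theory Defs
  imports "HOL-Algebra.Bij"
begin

text \<open>
  Conventions.  Categories have an explicit class of objects and indexed hom-sets (which need not be
  disjoint), and composition is written in diagrammatic order: \<open>cmp C x y z f g\<close> is
  \<open>x \<rightarrow> y \<rightarrow> z\<close>, first \<open>f\<close>, then \<open>g\<close>.
  Crossed modules, strict Gr-categories and Gr-functors are themselves objects and morphisms of
  categories here, so each of them must have exactly one representation in the logic.  Hence all their
  operations are required to be \<open>undefined\<close> outside their domains (as in
  \<^const>\<open>extensional\<close>), and all constructions below restrict their results accordingly.
\<close>

record ('o, 'm) cat =
  obj :: "'o set"
  mor :: "'o \<Rightarrow> 'o \<Rightarrow> 'm set"
  idt :: "'o \<Rightarrow> 'm"
  cmp :: "'o \<Rightarrow> 'o \<Rightarrow> 'o \<Rightarrow> 'm \<Rightarrow> 'm \<Rightarrow> 'm"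

definition category :: "('o, 'm, 'z) cat_scheme \<Rightarrow> bool" where
  "category C \<longleftrightarrow>
    (\<forall>x \<in> obj C. idt C x \<in> mor C x x) \<and>
    (\<forall>x \<in> obj C. \<forall>y \<in> obj C. \<forall>z \<in> obj C. \<forall>f \<in> mor C x y. \<forall>g \<in> mor C y z.
       cmp C x y z f g \<in> mor C x z) \<and>
    (\<forall>x \<in> obj C. \<forall>y \<in> obj C. \<forall>f \<in> mor C x y.
       cmp C x x y (idt C x) f = f \<and> cmp C x y y f (idt C y) = f) \<and>
    (\<forall>w \<in> obj C. \<forall>x \<in> obj C. \<forall>y \<in> obj C. \<forall>z \<in> obj C.
     \<forall>f \<in> mor C w x. \<forall>g \<in> mor C x y. \<forall>h \<in> mor C y z.
       cmp C w y z (cmp C w x y f g) h = cmp C w x z f (cmp C x y z g h))"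

definition is_iso :: "('o, 'm, 'z) cat_scheme \<Rightarrow> 'o \<Rightarrow> 'o \<Rightarrow> 'm \<Rightarrow> bool" where
  "is_iso C x y f \<longleftrightarrow> f \<in> mor C x y \<and>
     (\<exists>g \<in> mor C y x. cmp C x y x f g = idt C x \<and> cmp C y x y g f = idt C y)"

record ('o, 'm, 'p, 'n) fctr =
  fo :: "'o \<Rightarrow> 'p"
  fm :: "'o \<Rightarrow> 'o \<Rightarrow> 'm \<Rightarrow> 'n"

definition is_functor ::
  "('o, 'm, 'y) cat_scheme \<Rightarrow> ('p, 'n, 'z) cat_scheme \<Rightarrow> ('o, 'm, 'p, 'n, 'w) fctr_scheme \<Rightarrow> bool"
where
  "is_functor C C' F \<longleftrightarrow>
    (\<forall>x \<in> obj C. fo F x \<in> obj C') \<and>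
    (\<forall>x \<in> obj C. \<forall>y \<in> obj C. \<forall>f \<in> mor C x y. fm F x y f \<in> mor C' (fo F x) (fo F y)) \<and>
    (\<forall>x \<in> obj C. fm F x x (idt C x) = idt C' (fo F x)) \<and>
    (\<forall>x \<in> obj C. \<forall>y \<in> obj C. \<forall>z \<in> obj C. \<forall>f \<in> mor C x y. \<forall>g \<in> mor C y z.
       fm F x z (cmp C x y z f g) = cmp C' (fo F x) (fo F y) (fo F z) (fm F x y f) (fm F y z g))"

definition bij_functor ::
  "('o, 'm, 'y) cat_scheme \<Rightarrow> ('p, 'n, 'z) cat_scheme \<Rightarrow> ('o, 'm, 'p, 'n, 'w) fctr_scheme \<Rightarrow> bool"
where
  "bij_functor C C' F \<longleftrightarrow> is_functor C C' F \<and>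
    bij_betw (fo F) (obj C) (obj C') \<and>
    (\<forall>x \<in> obj C. \<forall>y \<in> obj C. bij_betw (fm F x y) (mor C x y) (mor C' (fo F x) (fo F y)))"

definition isomorphism_of_categories ::
  "('o, 'm, 'y) cat_scheme \<Rightarrow> ('p, 'n, 'z) cat_scheme \<Rightarrow> ('o, 'm, 'p, 'n, 'w) fctr_scheme \<Rightarrow> bool"
where
  "isomorphism_of_categories C C' F \<longleftrightarrow> category C \<and> category C' \<and> bij_functor C C' F"

definition full_subcat :: "('o, 'm) cat \<Rightarrow> 'o set \<Rightarrow> ('o, 'm) cat" where
  "full_subcat C S = C\<lparr>obj := obj C \<inter> S\<rparr>"

text \<open>Quotient of \<open>C\<close> by a relation \<open>R x y\<close> on every hom-set; the composite of two classes is
  the union of the classes of all composites of representatives, which is a single class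
  if \<open>R\<close> is a congruence.\<close>

definition quotient_cat :: "('o, 'm) cat \<Rightarrow> ('o \<Rightarrow> 'o \<Rightarrow> 'm rel) \<Rightarrow> ('o, 'm set) cat" where
  "quotient_cat C R =
    \<lparr> obj = obj C,
      mor = (\<lambda>x y. mor C x y // R x y),
      idt = (\<lambda>x. R x x `` {idt C x}),
      cmp = (\<lambda>x y z \<phi> \<psi>. \<Union>f \<in> \<phi>. \<Union>g \<in> \<psi>. R x z `` {cmp C x y z f g}) \<rparr>"

text \<open>\<open>xB\<close> is the (additively written) group \<open>B\<close>; as a HOL-Algebra group its operation is
  nevertheless \<open>\<otimes>\<close>.\<close>

record ('b, 'd) xmod =
  xB :: "'b monoid"
  xD :: "'d monoid"
  xd :: "'b \<Rightarrow> 'd"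
  xt :: "'d \<Rightarrow> 'b \<Rightarrow> 'b"

definition extensional_op :: "'a monoid \<Rightarrow> bool" where
  "extensional_op G \<longleftrightarrow>
    (\<forall>x y. \<not> (x \<in> carrier G \<and> y \<in> carrier G) \<longrightarrow> x \<otimes>\<^bsub>G\<^esub> y = undefined)"

definition crossed_module :: "('b, 'd) xmod \<Rightarrow> bool" where
  "crossed_module X \<longleftrightarrow>
    group (xB X) \<and> group (xD X) \<and>
    xd X \<in> hom (xB X) (xD X) \<and>
    xt X \<in> hom (xD X) (AutoGroup (xB X)) \<and>
    (\<forall>b \<in> carrier (xB X). \<forall>c \<in> carrier (xB X).
       xt X (xd X b) c = b \<otimes>\<^bsub>xB X\<^esub> c \<otimes>\<^bsub>xB X\<^esub> inv\<^bsub>xB X\<^esub> b) \<and>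
    (\<forall>x \<in> carrier (xD X). \<forall>b \<in> carrier (xB X).
       xd X (xt X x b) = x \<otimes>\<^bsub>xD X\<^esub> xd X b \<otimes>\<^bsub>xD X\<^esub> inv\<^bsub>xD X\<^esub> x) \<and>
    extensional_op (xB X) \<and> extensional_op (xD X) \<and>
    xd X \<in> extensional (carrier (xB X)) \<and> xt X \<in> extensional (carrier (xD X))"

definition xmod_morphism ::
  "('b, 'd) xmod \<Rightarrow> ('b', 'd') xmod \<Rightarrow> ('b \<Rightarrow> 'b') \<times> ('d \<Rightarrow> 'd') \<Rightarrow> bool" where
  "xmod_morphism X Y = (\<lambda>(f1, f0).
    f1 \<in> hom (xB X) (xB Y) \<and> f1 \<in> extensional (carrier (xB X)) \<and>
    f0 \<in> hom (xD X) (xD Y) \<and> f0 \<in> extensional (carrier (xD X)) \<and>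
    (\<forall>b \<in> carrier (xB X). f0 (xd X b) = xd Y (f1 b)) \<and>
    (\<forall>x \<in> carrier (xD X). \<forall>b \<in> carrier (xB X). f1 (xt X x b) = xt Y (f0 x) (f1 b)))"

definition xmod_isomorphism ::
  "('b, 'd) xmod \<Rightarrow> ('b', 'd') xmod \<Rightarrow> ('b \<Rightarrow> 'b') \<times> ('d \<Rightarrow> 'd') \<Rightarrow> bool" where
  "xmod_isomorphism X Y f \<longleftrightarrow> xmod_morphism X Y f \<and>
    bij_betw (fst f) (carrier (xB X)) (carrier (xB Y)) \<and>
    bij_betw (snd f) (carrier (xD X)) (carrier (xD Y))"

definition Cross :: "(('b, 'd) xmod, ('b \<Rightarrow> 'b) \<times> ('d \<Rightarrow> 'd)) cat" where
  "Cross =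
    \<lparr> obj = {X. crossed_module X},
      mor = (\<lambda>X Y. {f. xmod_morphism X Y f}),
      idt = (\<lambda>X. (\<lambda>b \<in> carrier (xB X). b, \<lambda>x \<in> carrier (xD X). x)),
      cmp = (\<lambda>X Y Z f g. (compose (carrier (xB X)) (fst g) (fst f),
                           compose (carrier (xD X)) (snd g) (snd f))) \<rparr>"

text \<open>\<open>tenM P x y x' y' f f' : x \<otimes> x' \<rightarrow> y \<otimes> y'\<close> is the tensor product of
  \<open>f : x \<rightarrow> y\<close> and \<open>f' : x' \<rightarrow> y'\<close>.\<close>

record ('o, 'm) smcat = "('o, 'm) cat" +
  tenO :: "'o \<Rightarrow> 'o \<Rightarrow> 'o"
  unt :: "'o"
  tenM :: "'o \<Rightarrow> 'o \<Rightarrow> 'o \<Rightarrow> 'o \<Rightarrow> 'm \<Rightarrow> 'm \<Rightarrow> 'm"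

definition strict_monoidal_category :: "('o, 'm) smcat \<Rightarrow> bool" where
  "strict_monoidal_category P \<longleftrightarrow>
    category P \<and>
    (\<forall>x \<in> obj P. \<forall>y \<in> obj P. tenO P x y \<in> obj P) \<and>
    (\<forall>x \<in> obj P. \<forall>y \<in> obj P. \<forall>x' \<in> obj P. \<forall>y' \<in> obj P. \<forall>f \<in> mor P x y. \<forall>f' \<in> mor P x' y'.
       tenM P x y x' y' f f' \<in> mor P (tenO P x x') (tenO P y y')) \<and>
    (\<forall>x \<in> obj P. \<forall>x' \<in> obj P.
       tenM P x x x' x' (idt P x) (idt P x') = idt P (tenO P x x')) \<and>
    (\<forall>x \<in> obj P. \<forall>y \<in> obj P. \<forall>z \<in> obj P. \<forall>x' \<in> obj P. \<forall>y' \<in> obj P. \<forall>z' \<in> obj P.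
     \<forall>f \<in> mor P x y. \<forall>g \<in> mor P y z. \<forall>f' \<in> mor P x' y'. \<forall>g' \<in> mor P y' z'.
       tenM P x z x' z' (cmp P x y z f g) (cmp P x' y' z' f' g') =
       cmp P (tenO P x x') (tenO P y y') (tenO P z z')
         (tenM P x y x' y' f f') (tenM P y z y' z' g g')) \<and>
    (\<forall>x \<in> obj P. \<forall>y \<in> obj P. \<forall>z \<in> obj P. tenO P (tenO P x y) z = tenO P x (tenO P y z)) \<and>
    (\<forall>x \<in> obj P. \<forall>y \<in> obj P. \<forall>x' \<in> obj P. \<forall>y' \<in> obj P. \<forall>x'' \<in> obj P. \<forall>y'' \<in> obj P.
     \<forall>f \<in> mor P x y. \<forall>f' \<in> mor P x' y'. \<forall>f'' \<in> mor P x'' y''.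
       tenM P (tenO P x x') (tenO P y y') x'' y'' (tenM P x y x' y' f f') f'' =
       tenM P x y (tenO P x' x'') (tenO P y' y'') f (tenM P x' y' x'' y'' f' f'')) \<and>
    unt P \<in> obj P \<and>
    (\<forall>x \<in> obj P. tenO P (unt P) x = x \<and> tenO P x (unt P) = x) \<and>
    (\<forall>x \<in> obj P. \<forall>y \<in> obj P. \<forall>f \<in> mor P x y.
       tenM P (unt P) (unt P) x y (idt P (unt P)) f = f \<and>
       tenM P x y (unt P) (unt P) f (idt P (unt P)) = f)"

definition smcat_extensional :: "('o, 'm) smcat \<Rightarrow> bool" where
  "smcat_extensional P \<longleftrightarrow>
    (\<forall>x y. \<not> (x \<in> obj P \<and> y \<in> obj P) \<longrightarrow> mor P x y = {} \<and> tenO P x y = undefined) \<and>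
    (\<forall>x. x \<notin> obj P \<longrightarrow> idt P x = undefined) \<and>
    (\<forall>x y z f g. \<not> (f \<in> mor P x y \<and> g \<in> mor P y z) \<longrightarrow> cmp P x y z f g = undefined) \<and>
    (\<forall>x y x' y' f f'. \<not> (f \<in> mor P x y \<and> f' \<in> mor P x' y') \<longrightarrow>
       tenM P x y x' y' f f' = undefined)"

definition strict_Gr_category :: "('o, 'm) smcat \<Rightarrow> bool" where
  "strict_Gr_category P \<longleftrightarrow>
    strict_monoidal_category P \<and>
    (\<forall>x \<in> obj P. \<forall>y \<in> obj P. \<forall>f \<in> mor P x y. is_iso P x y f) \<and>
    (\<forall>x \<in> obj P. \<exists>y \<in> obj P. tenO P x y = unt P \<and> tenO P y x = unt P) \<and>
    smcat_extensional P"

definition obj_group :: "('o, 'm) smcat \<Rightarrow> 'o monoid" where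
  "obj_group P = \<lparr> carrier = obj P, mult = tenO P, one = unt P \<rparr>"

abbreviation ob_inv :: "('o, 'm) smcat \<Rightarrow> 'o \<Rightarrow> 'o" where
  "ob_inv P x \<equiv> inv\<^bsub>obj_group P\<^esub> x"

definition gr_mor :: "('b, 'd) xmod \<Rightarrow> 'd \<Rightarrow> 'd \<Rightarrow> 'b set" where
  "gr_mor X x y = {b \<in> carrier (xB X).
     x \<in> carrier (xD X) \<and> y \<in> carrier (xD X) \<and> x = xd X b \<otimes>\<^bsub>xD X\<^esub> y}"

definition gr_of_xmod :: "('b, 'd) xmod \<Rightarrow> ('d, 'b) smcat" where
  "gr_of_xmod X =
    \<lparr> obj = carrier (xD X),
      mor = gr_mor X,
      idt = (\<lambda>x \<in> carrier (xD X). \<one>\<^bsub>xB X\<^esub>),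
      cmp = (\<lambda>x y z b c. if b \<in> gr_mor X x y \<and> c \<in> gr_mor X y z
                          then b \<otimes>\<^bsub>xB X\<^esub> c else undefined),
      tenO = mult (xD X),
      unt = \<one>\<^bsub>xD X\<^esub>,
      tenM = (\<lambda>x y x' y' b b'. if b \<in> gr_mor X x y \<and> b' \<in> gr_mor X x' y'
                                then b \<otimes>\<^bsub>xB X\<^esub> xt X y b' else undefined) \<rparr>"

text \<open>Hom-sets need not be disjoint, so a morphism \<open>b : x \<rightarrow> 1\<close> is represented as the pair
  \<open>(x, b)\<close>.\<close>

definition xmod_carrier :: "('o, 'm) smcat \<Rightarrow> ('o \<times> 'm) set" where
  "xmod_carrier P = {(x, b). x \<in> obj P \<and> b \<in> mor P x (unt P)}"

definition xmod_of_gr :: "('o, 'm) smcat \<Rightarrow> ('o \<times> 'm, 'o) xmod" where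
  "xmod_of_gr P =
    \<lparr> xB = \<lparr> carrier = xmod_carrier P,
             mult = (\<lambda>u v. if u \<in> xmod_carrier P \<and> v \<in> xmod_carrier P
                       then (tenO P (fst u) (fst v),
                             tenM P (fst u) (unt P) (fst v) (unt P) (snd u) (snd v))
                       else undefined),
             one = (unt P, idt P (unt P)) \<rparr>,
      xD = obj_group P,
      xd = (\<lambda>u \<in> xmod_carrier P. fst u),
      xt = (\<lambda>y \<in> obj P. \<lambda>u \<in> xmod_carrier P.
              (tenO P (tenO P y (fst u)) (ob_inv P y),
               tenM P (tenO P y (fst u)) y (ob_inv P y) (ob_inv P y)
                 (tenM P y y (fst u) (unt P) (idt P y) (snd u)) (idt P (ob_inv P y)))) \<rparr>"

text \<open>The element \<open>f \<otimes> id : x y\<^sup>-\<^sup>1 \<rightarrow> 1\<close> of the group \<open>B\<close> of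
  \<^term>\<open>xmod_of_gr P\<close> that is identified with the morphism \<open>f : x \<rightarrow> y\<close>.\<close>

definition as_element :: "('o, 'm) smcat \<Rightarrow> 'o \<Rightarrow> 'o \<Rightarrow> 'm \<Rightarrow> 'o \<times> 'm" where
  "as_element P x y f =
    (tenO P x (ob_inv P y), tenM P x y (ob_inv P y) (ob_inv P y) f (idt P (ob_inv P y)))"

text \<open>\<open>ften F x y : Fx \<otimes> Fy \<rightarrow> F(x \<otimes> y)\<close> and \<open>funt F : I' \<rightarrow> FI\<close>.\<close>

record ('o, 'm, 'p, 'n) grfctr = "('o, 'm, 'p, 'n) fctr" +
  ften :: "'o \<Rightarrow> 'o \<Rightarrow> 'n"
  funt :: "'n"

definition Gr_functor ::
  "('o, 'm) smcat \<Rightarrow> ('p, 'n) smcat \<Rightarrow> ('o, 'm, 'p, 'n) grfctr \<Rightarrow> bool" where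
  "Gr_functor P P' F \<longleftrightarrow>
    is_functor P P' F \<and>
    (\<forall>x \<in> obj P. \<forall>y \<in> obj P.
       is_iso P' (tenO P' (fo F x) (fo F y)) (fo F (tenO P x y)) (ften F x y)) \<and>
    (\<forall>x \<in> obj P. \<forall>y \<in> obj P. \<forall>x' \<in> obj P. \<forall>y' \<in> obj P. \<forall>f \<in> mor P x y. \<forall>f' \<in> mor P x' y'.
       cmp P' (tenO P' (fo F x) (fo F x')) (tenO P' (fo F y) (fo F y')) (fo F (tenO P y y'))
         (tenM P' (fo F x) (fo F y) (fo F x') (fo F y') (fm F x y f) (fm F x' y' f'))
         (ften F y y') =
       cmp P' (tenO P' (fo F x) (fo F x')) (fo F (tenO P x x')) (fo F (tenO P y y'))
         (ften F x x')
         (fm F (tenO P x x') (tenO P y y') (tenM P x y x' y' f f'))) \<and>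
    \<comment> \<open>coherence with the (identity) associativity constraints\<close>
    (\<forall>x \<in> obj P. \<forall>y \<in> obj P. \<forall>z \<in> obj P.
       cmp P' (tenO P' (tenO P' (fo F x) (fo F y)) (fo F z))
              (tenO P' (fo F (tenO P x y)) (fo F z))
              (fo F (tenO P (tenO P x y) z))
         (tenM P' (tenO P' (fo F x) (fo F y)) (fo F (tenO P x y)) (fo F z) (fo F z)
            (ften F x y) (idt P' (fo F z)))
         (ften F (tenO P x y) z) =
       cmp P' (tenO P' (fo F x) (tenO P' (fo F y) (fo F z)))
              (tenO P' (fo F x) (fo F (tenO P y z)))
              (fo F (tenO P x (tenO P y z)))
         (tenM P' (fo F x) (fo F x) (tenO P' (fo F y) (fo F z)) (fo F (tenO P y z))
            (idt P' (fo F x)) (ften F y z))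
         (ften F x (tenO P y z))) \<and>
    \<comment> \<open>coherence with the (identity) unit constraints\<close>
    is_iso P' (unt P') (fo F (unt P)) (funt F) \<and>
    (\<forall>x \<in> obj P.
       cmp P' (fo F x) (tenO P' (fo F (unt P)) (fo F x)) (fo F x)
         (tenM P' (unt P') (fo F (unt P)) (fo F x) (fo F x) (funt F) (idt P' (fo F x)))
         (ften F (unt P) x) = idt P' (fo F x) \<and>
       cmp P' (fo F x) (tenO P' (fo F x) (fo F (unt P))) (fo F x)
         (tenM P' (fo F x) (fo F x) (unt P') (fo F (unt P)) (idt P' (fo F x)) (funt F))
         (ften F x (unt P)) = idt P' (fo F x)) \<and>
    (\<forall>x. x \<notin> obj P \<longrightarrow> fo F x = undefined) \<and>
    (\<forall>x y f. f \<notin> mor P x y \<longrightarrow> fm F x y f = undefined) \<and>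
    (\<forall>x y. \<not> (x \<in> obj P \<and> y \<in> obj P) \<longrightarrow> ften F x y = undefined)"

definition Gr_id :: "('o, 'm) smcat \<Rightarrow> ('o, 'm, 'o, 'm) grfctr" where
  "Gr_id P =
    \<lparr> fo = (\<lambda>x \<in> obj P. x),
      fm = (\<lambda>x y. \<lambda>f \<in> mor P x y. f),
      ften = (\<lambda>x y. if x \<in> obj P \<and> y \<in> obj P then idt P (tenO P x y) else undefined),
      funt = idt P (unt P) \<rparr>"

definition Gr_comp ::
  "('o, 'm) smcat \<Rightarrow> ('p, 'n) smcat \<Rightarrow> ('q, 'k) smcat \<Rightarrow>
   ('o, 'm, 'p, 'n) grfctr \<Rightarrow> ('p, 'n, 'q, 'k) grfctr \<Rightarrow> ('o, 'm, 'q, 'k) grfctr" where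
  "Gr_comp P P' P'' F G =
    \<lparr> fo = (\<lambda>x \<in> obj P. fo G (fo F x)),
      fm = (\<lambda>x y. \<lambda>f \<in> mor P x y. fm G (fo F x) (fo F y) (fm F x y f)),
      ften = (\<lambda>x y. if x \<in> obj P \<and> y \<in> obj P
         then cmp P'' (tenO P'' (fo G (fo F x)) (fo G (fo F y)))
                      (fo G (tenO P' (fo F x) (fo F y)))
                      (fo G (fo F (tenO P x y)))
                (ften G (fo F x) (fo F y))
                (fm G (tenO P' (fo F x) (fo F y)) (fo F (tenO P x y)) (ften F x y))
         else undefined),
      funt = cmp P'' (unt P'') (fo G (unt P')) (fo G (fo F (unt P)))
               (funt G) (fm G (unt P') (fo F (unt P)) (funt F)) \<rparr>"

definition homotopic ::
  "('o, 'm) smcat \<Rightarrow> ('p, 'n) smcat \<Rightarrow>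
   ('o, 'm, 'p, 'n) grfctr \<Rightarrow> ('o, 'm, 'p, 'n) grfctr \<Rightarrow> bool" where
  "homotopic P P' F G \<longleftrightarrow> (\<exists>\<alpha>.
    (\<forall>x \<in> obj P. is_iso P' (fo F x) (fo G x) (\<alpha> x)) \<and>
    (\<forall>x \<in> obj P. \<forall>y \<in> obj P. \<forall>f \<in> mor P x y.
       cmp P' (fo F x) (fo F y) (fo G y) (fm F x y f) (\<alpha> y) =
       cmp P' (fo F x) (fo G x) (fo G y) (\<alpha> x) (fm G x y f)) \<and>
    (\<forall>x \<in> obj P. \<forall>y \<in> obj P.
       cmp P' (tenO P' (fo F x) (fo F y)) (tenO P' (fo G x) (fo G y)) (fo G (tenO P x y))
         (tenM P' (fo F x) (fo G x) (fo F y) (fo G y) (\<alpha> x) (\<alpha> y)) (ften G x y) =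
       cmp P' (tenO P' (fo F x) (fo F y)) (fo F (tenO P x y)) (fo G (tenO P x y))
         (ften F x y) (\<alpha> (tenO P x y))) \<and>
    cmp P' (unt P') (fo F (unt P)) (fo G (unt P)) (funt F) (\<alpha> (unt P)) = funt G)"

definition strong_homotopic ::
  "('o, 'm) smcat \<Rightarrow> ('p, 'n) smcat \<Rightarrow>
   ('o, 'm, 'p, 'n) grfctr \<Rightarrow> ('o, 'm, 'p, 'n) grfctr \<Rightarrow> bool" where
  "strong_homotopic P P' F G \<longleftrightarrow> homotopic P P' F G \<and> fo F = fo G \<and> fm F = fm G"

text \<open>The automorphism \<open>c\<close> of the unit object is the element \<open>(1', c)\<close> of the group \<open>B'\<close>.\<close>

definition single ::
  "('o, 'm) smcat \<Rightarrow> ('p, 'n) smcat \<Rightarrow> ('o, 'm, 'p, 'n) grfctr \<Rightarrow> bool" where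
  "single P P' F \<longleftrightarrow> (\<exists>c. is_iso P' (unt P') (unt P') c \<and>
    (\<forall>x \<in> obj P. \<forall>y \<in> obj P.
       as_element P' (tenO P' (fo F x) (fo F y)) (fo F (tenO P x y)) (ften F x y) = (unt P', c)))"

definition Grstr :: "(('o, 'm) smcat, ('o, 'm, 'o, 'm) grfctr) cat" where
  "Grstr =
    \<lparr> obj = {P. strict_Gr_category P},
      mor = (\<lambda>P Q. {F. Gr_functor P Q F \<and> single P Q F}),
      idt = Gr_id,
      cmp = Gr_comp \<rparr>"

definition strong_homotopy ::
  "('o, 'm) smcat \<Rightarrow> ('o, 'm) smcat \<Rightarrow> ('o, 'm, 'o, 'm) grfctr rel" where
  "strong_homotopy P Q =
    {(F, G). F \<in> mor Grstr P Q \<and> G \<in> mor Grstr P Q \<and> strong_homotopic P Q F G}"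

definition HoGrstr :: "(('o, 'm) smcat, ('o, 'm, 'o, 'm) grfctr set) cat" where
  "HoGrstr = quotient_cat Grstr strong_homotopy"

definition strict_Gr_isomorphism ::
  "('o, 'm) smcat \<Rightarrow> ('p, 'n) smcat \<Rightarrow> ('o, 'm, 'p, 'n) grfctr \<Rightarrow> bool" where
  "strict_Gr_isomorphism P P' F \<longleftrightarrow>
    Gr_functor P P' F \<and> bij_functor P P' F \<and>
    (\<forall>x \<in> obj P. \<forall>y \<in> obj P.
       tenO P' (fo F x) (fo F y) = fo F (tenO P x y) \<and> ften F x y = idt P' (fo F (tenO P x y))) \<and>
    fo F (unt P) = unt P' \<and> funt F = idt P' (unt P')"

text \<open>Identity on objects, and \<open>(b : x y\<^sup>-\<^sup>1 \<rightarrow> 1) \<mapsto> (b \<otimes> id : x \<rightarrow> y)\<close> on morphisms.\<close>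

definition gr_ident :: "('o, 'm) smcat \<Rightarrow> ('o, 'o \<times> 'm, 'o, 'm) grfctr" where
  "gr_ident P =
    \<lparr> fo = (\<lambda>x \<in> obj P. x),
      fm = (\<lambda>x y. \<lambda>u \<in> mor (gr_of_xmod (xmod_of_gr P)) x y.
              tenM P (fst u) (unt P) y y (snd u) (idt P y)),
      ften = (\<lambda>x y. if x \<in> obj P \<and> y \<in> obj P then idt P (tenO P x y) else undefined),
      funt = idt P (unt P) \<rparr>"

definition xmod_ident :: "('b, 'd) xmod \<Rightarrow> ('b \<Rightarrow> 'd \<times> 'b) \<times> ('d \<Rightarrow> 'd)" where
  "xmod_ident X = (\<lambda>b \<in> carrier (xB X). (xd X b, b), \<lambda>x \<in> carrier (xD X). x)"

text \<open>The set of morphisms \<open>P \<rightarrow> Q\<close> corresponding to a set of morphisms between the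
  Gr-categories that are identified with \<open>P\<close> and \<open>Q\<close>.\<close>

definition transport_ident ::
  "('o, 'm) smcat \<Rightarrow> ('o, 'm) smcat \<Rightarrow>
   ('o, 'o \<times> 'm, 'o, 'o \<times> 'm) grfctr set \<Rightarrow> ('o, 'm, 'o, 'm) grfctr set" where
  "transport_ident P Q \<phi> = {F \<in> mor Grstr P Q. \<exists>F' \<in> \<phi>.
     Gr_comp (gr_of_xmod (xmod_of_gr P)) P Q (gr_ident P) F =
     Gr_comp (gr_of_xmod (xmod_of_gr P)) (gr_of_xmod (xmod_of_gr Q)) Q F' (gr_ident Q)}"

end

theory Submission
  imports Defs
begin

text \<open>
  The arrows of a strict Gr-category form a group under the tensor product, in which the composite of
  \<open>f : x \<rightarrow> y\<close> and \<open>g : y \<rightarrow> z\<close> is \<open>f \<otimes> id y\<^sup>-\<^sup>1 \<otimes> g\<close>.  Hence \<open>f \<mapsto> f \<otimes> id y\<^sup>-\<^sup>1\<close> turns composition into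
  the multiplication of \<open>B\<close> and the tensor product into \<open>(u, v) \<mapsto> u (\<theta> y v)\<close>, and it is injective on
  hom-sets, so that every coherence equation becomes an equation in \<open>B\<close>.

  If \<open>F\<close> is single with constant \<open>\<gamma>\<close>, then \<open>\<gamma>\<close> lies in the kernel of \<open>d\<close> and so is central.
  Naturality therefore says that \<open>F\<close> preserves tensor products strictly, associativity that \<open>\<gamma>\<close> is fixed
  by all \<open>\<theta> (F x)\<close>, and the unit conditions that the unit constraint is \<open>\<gamma>\<^sup>-\<^sup>1\<close>; conversely these
  properties suffice.  Two single functors with constants \<open>\<gamma>\<close>, \<open>\<delta>\<close> over the same \<open>F\<close> are homotopic through
  the constant transformation \<open>\<gamma> \<delta>\<^sup>-\<^sup>1\<close>, and every strict \<open>F\<close> occurs with \<open>\<gamma> = 1\<close>.  So a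
  strong homotopy class is just a strict functor, which for \<open>gr_of_xmod X\<close> and \<open>gr_of_xmod Y\<close> is the
  same as a morphism of crossed modules.
\<close>

section \<open>The group of arrows of a strict Gr-category\<close>

text \<open>Hom-sets may overlap, so source and target are part of an element. The tensor product is
  total on such triples, whereas composition is only partial.\<close>

definition arr_group :: "('o, 'm) smcat \<Rightarrow> ('o \<times> 'o \<times> 'm) monoid" where
  "arr_group P =
    \<lparr> carrier = {(x, y, f). x \<in> obj P \<and> y \<in> obj P \<and> f \<in> mor P x y},
      mult = (\<lambda>(x, y, f) (x', y', f'). (tenO P x x', tenO P y y', tenM P x y x' y' f f')),
      one = (unt P, unt P, idt P (unt P)) \<rparr>"

text \<open>Embeds \<open>B\<close> into the group of arrows as the arrows with target 1, that is,
  as the kernel of the target map.\<close>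

definition to_arr :: "('o, 'm) smcat \<Rightarrow> 'o \<times> 'm \<Rightarrow> 'o \<times> 'o \<times> 'm" where
  "to_arr P u = (fst u, unt P, snd u)"

text \<open>Inverse to \<open>as_element\<close> once the target \<open>y\<close> is fixed; the
  formula is the one used on morphisms in \<open>gr_ident\<close>.\<close>

definition of_element :: "('o, 'm) smcat \<Rightarrow> 'o \<Rightarrow> 'o \<times> 'm \<Rightarrow> 'm" where
  "of_element P y u = tenM P (fst u) (unt P) y y (snd u) (idt P y)"

locale strict_Gr =
  fixes P :: "('o, 'm) smcat"
  assumes gr: "strict_Gr_category P"
begin

abbreviation A where "A \<equiv> arr_group P"
abbreviation C where "C \<equiv> xmod_of_gr P"
abbreviation e where "e \<equiv> as_element P"
abbreviation i where "i y \<equiv> (y, y, idt P y)"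

section \<open>The axioms of a strict Gr-category, restated for single arrows\<close>

lemma smc: "strict_monoidal_category P"
  using gr by (simp add: strict_Gr_category_def)

lemma cat: "category P"
  using smc by (simp add: strict_monoidal_category_def)

lemma ext: "smcat_extensional P"
  using gr by (simp add: strict_Gr_category_def)

lemma mor_obj: "f \<in> mor P x y \<Longrightarrow> x \<in> obj P \<and> y \<in> obj P"
  using ext unfolding smcat_extensional_def by blast

lemma idt_mor [simp, intro]: "x \<in> obj P \<Longrightarrow> idt P x \<in> mor P x x"
  using cat by (simp add: category_def)

lemma cmp_mor [simp, intro]: "f \<in> mor P x y \<Longrightarrow> g \<in> mor P y z \<Longrightarrow> cmp P x y z f g \<in> mor P x z"
  using cat mor_obj unfolding category_def by blast

lemma cmp_id [simp]:
  "f \<in> mor P x y \<Longrightarrow> cmp P x x y (idt P x) f = f"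
  "f \<in> mor P x y \<Longrightarrow> cmp P x y y f (idt P y) = f"
  using cat mor_obj unfolding category_def by blast+

lemma cmp_assoc:
  "f \<in> mor P w x \<Longrightarrow> g \<in> mor P x y \<Longrightarrow> h \<in> mor P y z \<Longrightarrow>
   cmp P w y z (cmp P w x y f g) h = cmp P w x z f (cmp P x y z g h)"
  using cat mor_obj unfolding category_def by metis

lemma tenO_obj [simp, intro]: "x \<in> obj P \<Longrightarrow> y \<in> obj P \<Longrightarrow> tenO P x y \<in> obj P"
  using smc by (simp add: strict_monoidal_category_def)

lemma tenM_mor [intro]:
  "f \<in> mor P x y \<Longrightarrow> f' \<in> mor P x' y' \<Longrightarrow>
   tenM P x y x' y' f f' \<in> mor P (tenO P x x') (tenO P y y')"
  using smc mor_obj unfolding strict_monoidal_category_def by meson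

lemma tenM_idt [simp]:
  "x \<in> obj P \<Longrightarrow> x' \<in> obj P \<Longrightarrow> tenM P x x x' x' (idt P x) (idt P x') = idt P (tenO P x x')"
  using smc by (simp add: strict_monoidal_category_def)

lemma interchange:
  assumes "f \<in> mor P x y" "g \<in> mor P y z" "f' \<in> mor P x' y'" "g' \<in> mor P y' z'"
  shows "tenM P x z x' z' (cmp P x y z f g) (cmp P x' y' z' f' g') =
       cmp P (tenO P x x') (tenO P y y') (tenO P z z')
         (tenM P x y x' y' f f') (tenM P y z y' z' g g')"
  using smc mor_obj assms unfolding strict_monoidal_category_def by metis

lemma tenO_assoc:
  "x \<in> obj P \<Longrightarrow> y \<in> obj P \<Longrightarrow> z \<in> obj P \<Longrightarrow> tenO P (tenO P x y) z = tenO P x (tenO P y z)"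
  using smc by (simp add: strict_monoidal_category_def)

lemma tenM_assoc:
  assumes "f \<in> mor P x y" "f' \<in> mor P x' y'" "f'' \<in> mor P x'' y''"
  shows "tenM P (tenO P x x') (tenO P y y') x'' y'' (tenM P x y x' y' f f') f'' =
       tenM P x y (tenO P x' x'') (tenO P y' y'') f (tenM P x' y' x'' y'' f' f'')"
  using smc mor_obj assms unfolding strict_monoidal_category_def by metis

lemma unt_obj [simp, intro]: "unt P \<in> obj P"
  using smc by (simp add: strict_monoidal_category_def)

lemma tenO_unt [simp]: "x \<in> obj P \<Longrightarrow> tenO P (unt P) x = x" "x \<in> obj P \<Longrightarrow> tenO P x (unt P) = x"
  using smc by (simp_all add: strict_monoidal_category_def)

lemma tenM_unt [simp]:
  "f \<in> mor P x y \<Longrightarrow> tenM P (unt P) (unt P) x y (idt P (unt P)) f = f"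
  "f \<in> mor P x y \<Longrightarrow> tenM P x y (unt P) (unt P) f (idt P (unt P)) = f"
  using smc mor_obj unfolding strict_monoidal_category_def by metis+

lemma mor_iso: "f \<in> mor P x y \<Longrightarrow> is_iso P x y f"
  using gr mor_obj unfolding strict_Gr_category_def by blast

lemma obj_group_simps [simp]:
  "carrier (obj_group P) = obj P" "mult (obj_group P) = tenO P" "one (obj_group P) = unt P"
  by (simp_all add: obj_group_def)

lemma group_obj: "group (obj_group P)"
proof (rule groupI)
  show "\<exists>y\<in>carrier (obj_group P). y \<otimes>\<^bsub>obj_group P\<^esub> x = \<one>\<^bsub>obj_group P\<^esub>"
    if "x \<in> carrier (obj_group P)" for x
    using gr that unfolding strict_Gr_category_def by auto
qed (auto simp: tenO_assoc)

text \<open>The rewrites let the group laws of the objects apply directly to \<open>tenO P\<close>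
  and \<open>unt P\<close>.\<close>

sublocale D: group "obj_group P"
  rewrites "carrier (obj_group P) = obj P" and "mult (obj_group P) = tenO P"
    and "one (obj_group P) = unt P"
  by (simp_all add: group_obj)

section \<open>The tensor product as a group structure on arrows\<close>

lemma arr_simps:
  "(x, y, f) \<in> carrier A \<longleftrightarrow> x \<in> obj P \<and> y \<in> obj P \<and> f \<in> mor P x y"
  "(x, y, f) \<otimes>\<^bsub>A\<^esub> (x', y', f') = (tenO P x x', tenO P y y', tenM P x y x' y' f f')"
  "\<one>\<^bsub>A\<^esub> = i (unt P)"
  by (simp_all add: arr_group_def)

lemma arr_mem: "f \<in> mor P x y \<Longrightarrow> (x, y, f) \<in> carrier A"
  by (simp add: arr_simps mor_obj)

text \<open>This is the interchange law with identities inserted. Here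
  \<open>?h : 1 -> y\<^sup>-\<^sup>1 z\<close> is \<open>g\<close> shifted by the inverse of
  \<open>y\<close>, and \<open>f\<close> tensored with \<open>?h\<close> is \<open>f\<close>
  followed by the identity of \<open>y\<close> tensored with \<open>?h\<close>, that is, by
  \<open>g\<close>. Inserting the identities on the other side, with
  \<open>?k : y\<^sup>-\<^sup>1 x -> 1\<close>, gives the second formula, where \<open>f\<close> and
  \<open>g\<close> are swapped. The second formula yields tensor inverses, and both together yield
  the Peiffer identity.\<close>

lemma cmp_arr_aux:
  assumes f: "f \<in> mor P x y" and g: "g \<in> mor P y z"
  shows "(x, z, cmp P x y z f g) = (x, y, f) \<otimes>\<^bsub>A\<^esub> (i (ob_inv P y) \<otimes>\<^bsub>A\<^esub> (y, z, g))"
    and "(x, z, cmp P x y z f g) = (y, z, g) \<otimes>\<^bsub>A\<^esub> (i (ob_inv P y) \<otimes>\<^bsub>A\<^esub> (x, y, f))"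
proof -
  have o: "x \<in> obj P" "y \<in> obj P" "z \<in> obj P" using f g mor_obj by auto
  let ?v = "ob_inv P y"
  let ?h = "tenM P ?v ?v y z (idt P ?v) g"
  let ?k = "tenM P ?v ?v x y (idt P ?v) f"
  have v: "?v \<in> obj P" "tenO P ?v y = unt P" "tenO P y ?v = unt P"
    using o by simp_all
  have cancel: "tenO P y (tenO P ?v w) = w" if "w \<in> obj P" for w
    using that o v by (simp flip: tenO_assoc)
  have h: "?h \<in> mor P (unt P) (tenO P ?v z)"
    using tenM_mor[OF idt_mor[OF v(1)] g] v by simp
  have k: "?k \<in> mor P (tenO P ?v x) (unt P)"
    using tenM_mor[OF idt_mor[OF v(1)] f] v by simp
  have yh: "tenM P y y (unt P) (tenO P ?v z) (idt P y) ?h = g"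
    using tenM_assoc[OF idt_mor[OF o(2)] idt_mor[OF v(1)] g] o v g by simp
  have yk: "tenM P y y (tenO P ?v x) (unt P) (idt P y) ?k = f"
    using tenM_assoc[OF idt_mor[OF o(2)] idt_mor[OF v(1)] f] o v f by simp
  have "tenM P x y (unt P) (tenO P ?v z) f ?h = cmp P x y z f g"
    using interchange[OF f idt_mor[OF o(2)] idt_mor[OF unt_obj] h] o v f g h yh cancel
    by simp
  then show "(x, z, cmp P x y z f g) = (x, y, f) \<otimes>\<^bsub>A\<^esub> (i ?v \<otimes>\<^bsub>A\<^esub> (y, z, g))"
    using o v cancel by (simp add: arr_simps)
  have "tenM P y z (tenO P ?v x) (unt P) g ?k = cmp P x y z f g"
    using interchange[OF idt_mor[OF o(2)] g k idt_mor[OF unt_obj]] o v f g k yk cancel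
    by simp
  then show "(x, z, cmp P x y z f g) = (y, z, g) \<otimes>\<^bsub>A\<^esub> (i ?v \<otimes>\<^bsub>A\<^esub> (x, y, f))"
    using o v cancel by (simp add: arr_simps)
qed

lemma idt_arr_mem [simp, intro]: "y \<in> obj P \<Longrightarrow> i y \<in> carrier A"
  by (simp add: arr_simps)

lemma idt_arr_mult: "x \<in> obj P \<Longrightarrow> y \<in> obj P \<Longrightarrow> i x \<otimes>\<^bsub>A\<^esub> i y = i (tenO P x y)"
  by (simp add: arr_simps)

lemma arr_closed: "a \<in> carrier A \<Longrightarrow> b \<in> carrier A \<Longrightarrow> a \<otimes>\<^bsub>A\<^esub> b \<in> carrier A"
  by (cases a; cases b) (auto simp: arr_simps)

lemma arr_assoc:
  "a \<in> carrier A \<Longrightarrow> b \<in> carrier A \<Longrightarrow> c \<in> carrier A \<Longrightarrow>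
    (a \<otimes>\<^bsub>A\<^esub> b) \<otimes>\<^bsub>A\<^esub> c = a \<otimes>\<^bsub>A\<^esub> (b \<otimes>\<^bsub>A\<^esub> c)"
  by (cases a; cases b; cases c) (auto simp: arr_simps tenO_assoc tenM_assoc)

lemma group_arr: "group A"
proof (rule groupI)
  show one: "\<one>\<^bsub>A\<^esub> \<otimes>\<^bsub>A\<^esub> a = a" if "a \<in> carrier A" for a
    using that by (cases a) (simp add: arr_simps)
  show "\<one>\<^bsub>A\<^esub> \<in> carrier A" by (simp add: arr_simps)
  show "\<exists>b\<in>carrier A. b \<otimes>\<^bsub>A\<^esub> a = \<one>\<^bsub>A\<^esub>" if a: "a \<in> carrier A" for a
  proof -
    obtain x y f where af: "a = (x, y, f)" by (cases a)
    have f: "f \<in> mor P x y" "x \<in> obj P" "y \<in> obj P" using a af by (auto simp: arr_simps)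
    obtain g where g: "g \<in> mor P y x" "cmp P x y x f g = idt P x"
      using mor_iso[OF f(1)] by (auto simp: is_iso_def)
    \<comment> \<open>the second formula for composition turns \<open>f ; g = id\<close> into a tensor inverse of \<open>f\<close>\<close>
    let ?b = "i (ob_inv P x) \<otimes>\<^bsub>A\<^esub> ((y, x, g) \<otimes>\<^bsub>A\<^esub> i (ob_inv P y))"
    have m: "(y, x, g) \<in> carrier A" "i (ob_inv P y) \<in> carrier A" "i (ob_inv P x) \<in> carrier A"
      using f g by (auto simp: arr_mem)
    have "?b \<otimes>\<^bsub>A\<^esub> a = i (ob_inv P x) \<otimes>\<^bsub>A\<^esub> ((y, x, g) \<otimes>\<^bsub>A\<^esub> (i (ob_inv P y) \<otimes>\<^bsub>A\<^esub> a))"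
      using m a by (simp add: arr_assoc arr_closed)
    also have "\<dots> = i (ob_inv P x) \<otimes>\<^bsub>A\<^esub> i x"
      using cmp_arr_aux(2)[OF f(1) g(1)] g(2) af by simp
    also have "\<dots> = \<one>\<^bsub>A\<^esub>" using f by (simp add: arr_simps)
    finally show ?thesis using m by (meson arr_closed)
  qed
qed (auto simp: arr_closed arr_assoc)

sublocale A: group A by (rule group_arr)

lemma idt_arr_inv: "y \<in> obj P \<Longrightarrow> i (ob_inv P y) = inv\<^bsub>A\<^esub> (i y)"
  by (rule A.inv_equality[symmetric]) (auto simp: idt_arr_mult arr_simps)

lemma cmp_arr:
  assumes "f \<in> mor P x y" "g \<in> mor P y z"
  shows "(x, z, cmp P x y z f g) = (x, y, f) \<otimes>\<^bsub>A\<^esub> (inv\<^bsub>A\<^esub> (i y) \<otimes>\<^bsub>A\<^esub> (y, z, g))"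
    and "(x, z, cmp P x y z f g) = (y, z, g) \<otimes>\<^bsub>A\<^esub> (inv\<^bsub>A\<^esub> (i y) \<otimes>\<^bsub>A\<^esub> (x, y, f))"
  using cmp_arr_aux[OF assms] mor_obj[OF assms(1)] by (simp_all add: idt_arr_inv)

lemma A_cancel [simp]:
  assumes "a \<in> carrier A" "b \<in> carrier A"
  shows "a \<otimes>\<^bsub>A\<^esub> (inv\<^bsub>A\<^esub> a \<otimes>\<^bsub>A\<^esub> b) = b" "inv\<^bsub>A\<^esub> a \<otimes>\<^bsub>A\<^esub> (a \<otimes>\<^bsub>A\<^esub> b) = b"
  using assms by (simp_all flip: A.m_assoc)

section \<open>\<open>B\<close> as a subgroup of the group of arrows\<close>

abbreviation j where "j \<equiv> to_arr P"

abbreviation B where "B \<equiv> xB C"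

lemma xmod_simps [simp]:
  "xD C = obj_group P"
  "u \<in> carrier B \<Longrightarrow> xd C u = fst u"
  by (simp_all add: xmod_of_gr_def)

lemma carrier_B: "u \<in> carrier B \<longleftrightarrow> j u \<in> carrier A"
  by (cases u) (auto simp: xmod_of_gr_def xmod_carrier_def to_arr_def arr_simps)

lemma to_arr_mem [simp]: "u \<in> carrier B \<Longrightarrow> j u \<in> carrier A"
  by (simp add: carrier_B)

text \<open>Reduces an equation in \<open>B\<close> to one in \<open>A\<close>; most laws of
  \<open>B\<close> below are proved this way.\<close>

lemma to_arr_inj: "j u = j v \<Longrightarrow> u = v"
  by (simp add: to_arr_def prod_eq_iff)

lemma to_arr_mult: "u \<in> carrier B \<Longrightarrow> v \<in> carrier B \<Longrightarrow> j (u \<otimes>\<^bsub>B\<^esub> v) = j u \<otimes>\<^bsub>A\<^esub> j v"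
  by (auto simp: xmod_of_gr_def to_arr_def arr_simps)

lemma to_arr_one [simp]: "j \<one>\<^bsub>B\<^esub> = \<one>\<^bsub>A\<^esub>"
  by (simp add: to_arr_def arr_simps xmod_of_gr_def)

text \<open>Source and target are thus homomorphisms from \<open>A\<close> to the group of objects,
  which gives \<open>B\<close> its inverses.\<close>

lemma A_hom:
  "a \<in> carrier A \<Longrightarrow> fst a \<in> obj P" "a \<in> carrier A \<Longrightarrow> fst (snd a) \<in> obj P"
  "fst (a \<otimes>\<^bsub>A\<^esub> b) = tenO P (fst a) (fst b)"
  "fst (snd (a \<otimes>\<^bsub>A\<^esub> b)) = tenO P (fst (snd a)) (fst (snd b))"
  by (cases a; cases b; auto simp: arr_simps)+

lemma A_inv_hom:
  assumes "a \<in> carrier A"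
  shows "fst (inv\<^bsub>A\<^esub> a) = ob_inv P (fst a)" "fst (snd (inv\<^bsub>A\<^esub> a)) = ob_inv P (fst (snd a))"
proof -
  have "tenO P (fst (inv\<^bsub>A\<^esub> a)) (fst a) = unt P"
    "tenO P (fst (snd (inv\<^bsub>A\<^esub> a))) (fst (snd a)) = unt P"
    using assms A_hom(3,4)[of "inv\<^bsub>A\<^esub> a" a] by (simp_all add: arr_simps)
  then show "fst (inv\<^bsub>A\<^esub> a) = ob_inv P (fst a)"
    "fst (snd (inv\<^bsub>A\<^esub> a)) = ob_inv P (fst (snd a))"
    using assms by (simp_all add: A_hom D.inv_equality)
qed

lemma to_arr_surj: "a \<in> carrier A \<Longrightarrow> fst (snd a) = unt P \<Longrightarrow> \<exists>u\<in>carrier B. j u = a"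
  by (cases a) (auto simp: carrier_B to_arr_def intro!: bexI[of _ "(fst a, snd (snd a))"])

text \<open>The laws are inherited from \<open>A\<close> along the injective map \<open>j\<close>.
  Inverses stay in \<open>B\<close> because the target map is a homomorphism.\<close>

lemma group_B: "group B"
proof (rule groupI)
  show "u \<otimes>\<^bsub>B\<^esub> v \<in> carrier B" if "u \<in> carrier B" "v \<in> carrier B" for u v
    using that by (simp add: carrier_B to_arr_mult)
  then show "u \<otimes>\<^bsub>B\<^esub> v \<otimes>\<^bsub>B\<^esub> w = u \<otimes>\<^bsub>B\<^esub> (v \<otimes>\<^bsub>B\<^esub> w)"
    if "u \<in> carrier B" "v \<in> carrier B" "w \<in> carrier B" for u v w
    using that by (intro to_arr_inj) (simp add: to_arr_mult A.m_assoc)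
  show "\<one>\<^bsub>B\<^esub> \<in> carrier B" unfolding carrier_B to_arr_one by simp
  then show "\<one>\<^bsub>B\<^esub> \<otimes>\<^bsub>B\<^esub> u = u" if "u \<in> carrier B" for u
    using that by (intro to_arr_inj) (simp add: to_arr_mult)
  show "\<exists>v\<in>carrier B. v \<otimes>\<^bsub>B\<^esub> u = \<one>\<^bsub>B\<^esub>" if u: "u \<in> carrier B" for u
  proof -
    have "fst (snd (inv\<^bsub>A\<^esub> (j u))) = unt P"
      using u by (simp add: A_inv_hom) (simp add: to_arr_def)
    then obtain v where v: "v \<in> carrier B" "j v = inv\<^bsub>A\<^esub> (j u)"
      using to_arr_surj u by (metis A.inv_closed to_arr_mem)
    then have "v \<otimes>\<^bsub>B\<^esub> u = \<one>\<^bsub>B\<^esub>"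
      using u by (intro to_arr_inj) (simp add: to_arr_mult)
    then show ?thesis using v by blast
  qed
qed

sublocale B: group B by (rule group_B)

section \<open>Translation of arrows into elements of \<open>B\<close>\<close>

lemma to_arr_as_element: "f \<in> mor P x y \<Longrightarrow> j (e x y f) = (x, y, f) \<otimes>\<^bsub>A\<^esub> inv\<^bsub>A\<^esub> (i y)"
  using mor_obj by (simp flip: idt_arr_inv) (simp add: to_arr_def as_element_def arr_simps)

lemma as_element_mem [simp, intro]: "f \<in> mor P x y \<Longrightarrow> e x y f \<in> carrier B"
  using mor_obj unfolding carrier_B by (simp add: to_arr_as_element arr_mem)

lemma fst_as_element [simp]: "fst (e x y f) = tenO P x (ob_inv P y)"
  by (simp add: as_element_def)

text \<open>The action is conjugation by the identity arrow of \<open>y\<close>, so the laws of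
  \<open>xt\<close> below become laws of conjugation in \<open>A\<close>.\<close>

lemma to_arr_xt:
  "y \<in> obj P \<Longrightarrow> u \<in> carrier B \<Longrightarrow>
   j (xt C y u) = i y \<otimes>\<^bsub>A\<^esub> (j u \<otimes>\<^bsub>A\<^esub> inv\<^bsub>A\<^esub> (i y))"
proof -
  assume y: "y \<in> obj P" and u: "u \<in> carrier B"
  have "j (xt C y u) = (i y \<otimes>\<^bsub>A\<^esub> j u) \<otimes>\<^bsub>A\<^esub> i (ob_inv P y)"
    using y u by (auto simp: xmod_of_gr_def to_arr_def arr_simps)
  then show ?thesis using y u by (simp add: idt_arr_inv A.m_assoc)
qed

lemma t_mem [simp, intro]: "y \<in> obj P \<Longrightarrow> u \<in> carrier B \<Longrightarrow> xt C y u \<in> carrier B"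
  by (simp add: carrier_B to_arr_xt)

lemma fst_mem [simp]: "u \<in> carrier B \<Longrightarrow> fst u \<in> obj P"
  by (auto simp: carrier_B to_arr_def arr_simps)

text \<open>In \<open>A\<close>, with objects standing for their identities, both sides are
  \<open>f y\<^sup>-\<^sup>1 g z\<^sup>-\<^sup>1\<close>: composition inserts exactly the inverse
  that separates the two factors.\<close>

lemma as_element_cmp [simp]:
  assumes "f \<in> mor P x y" "g \<in> mor P y z"
  shows "e x z (cmp P x y z f g) = e x y f \<otimes>\<^bsub>B\<^esub> e y z g"
  using assms mor_obj[OF assms(1)] mor_obj[OF assms(2)]
  by (intro to_arr_inj) (simp add: to_arr_mult to_arr_as_element cmp_arr(1) A.m_assoc arr_mem)

text \<open>In \<open>A\<close>, with objects standing for their identities, this is \<open>f f' (y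
  y')\<^sup>-\<^sup>1 = f y\<^sup>-\<^sup>1 (y (f' y'\<^sup>-\<^sup>1) y\<^sup>-\<^sup>1)\<close>,
  and the conjugation by \<open>y\<close> is the action.\<close>

lemma as_element_ten [simp]:
  assumes "f \<in> mor P x y" "f' \<in> mor P x' y'"
  shows "e (tenO P x x') (tenO P y y') (tenM P x y x' y' f f') = e x y f \<otimes>\<^bsub>B\<^esub> xt C y (e x' y' f')"
proof (rule to_arr_inj)
  have o: "y \<in> obj P" "y' \<in> obj P" using assms mor_obj by auto
  have "j (e (tenO P x x') (tenO P y y') (tenM P x y x' y' f f'))
    = (x, y, f) \<otimes>\<^bsub>A\<^esub> (x', y', f') \<otimes>\<^bsub>A\<^esub> inv\<^bsub>A\<^esub> (i y \<otimes>\<^bsub>A\<^esub> i y')"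
    using assms o by (simp add: to_arr_as_element tenM_mor idt_arr_mult) (simp add: arr_simps)
  also have "\<dots> = j (e x y f \<otimes>\<^bsub>B\<^esub> xt C y (e x' y' f'))"
    using assms o by (simp add: to_arr_mult to_arr_xt to_arr_as_element A.m_assoc A.inv_mult_group arr_mem)
  finally show "j (e (tenO P x x') (tenO P y y') (tenM P x y x' y' f f'))
    = j (e x y f \<otimes>\<^bsub>B\<^esub> xt C y (e x' y' f'))" .
qed

lemma as_element_idt [simp]: "x \<in> obj P \<Longrightarrow> e x x (idt P x) = \<one>\<^bsub>B\<^esub>"
  by (rule to_arr_inj) (simp add: to_arr_as_element)

text \<open>Right cancellation in \<open>A\<close>. It allows an equation between parallel arrows to
  be checked in \<open>B\<close>.\<close>

lemma as_element_inj: "e x y f = e x y g \<Longrightarrow> f \<in> mor P x y \<Longrightarrow> g \<in> mor P x y \<Longrightarrow> f = g"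
proof -
  assume e: "e x y f = e x y g" and f: "f \<in> mor P x y" "g \<in> mor P x y"
  then have "(x, y, f) \<otimes>\<^bsub>A\<^esub> inv\<^bsub>A\<^esub> (i y) = (x, y, g) \<otimes>\<^bsub>A\<^esub> inv\<^bsub>A\<^esub> (i y)"
    by (metis to_arr_as_element)
  then show ?thesis using f mor_obj by (simp add: arr_mem)
qed

abbreviation m where "m \<equiv> of_element P"

lemma to_arr_of_element: "u \<in> carrier B \<Longrightarrow> y \<in> obj P \<Longrightarrow> (tenO P (fst u) y, y, m y u) = j u \<otimes>\<^bsub>A\<^esub> i y"
  by (simp add: arr_simps to_arr_def of_element_def)

lemma of_element_mor: "u \<in> carrier B \<Longrightarrow> x = tenO P (fst u) y \<Longrightarrow> y \<in> obj P \<Longrightarrow> m y u \<in> mor P x y"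
  using A.m_closed[of "j u" "i y"] by (simp flip: to_arr_of_element) (simp add: arr_simps)

lemma as_element_of_element: "u \<in> carrier B \<Longrightarrow> x = tenO P (fst u) y \<Longrightarrow> y \<in> obj P \<Longrightarrow> e x y (m y u) = u"
  by (rule to_arr_inj) (simp add: to_arr_as_element of_element_mor to_arr_of_element A.m_assoc)

lemma of_element_as_element: "f \<in> mor P x y \<Longrightarrow> m y (e x y f) = f"
  by (rule as_element_inj[of x y]) (use mor_obj in \<open>auto simp: as_element_of_element of_element_mor D.m_assoc\<close>)

section \<open>The action and the crossed module axioms\<close>

lemma xt_mult:
  "y \<in> obj P \<Longrightarrow> u \<in> carrier B \<Longrightarrow> v \<in> carrier B \<Longrightarrow>
   xt C y (u \<otimes>\<^bsub>B\<^esub> v) = xt C y u \<otimes>\<^bsub>B\<^esub> xt C y v"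
  by (rule to_arr_inj) (simp add: to_arr_mult to_arr_xt A.m_assoc)

lemma xt_xt:
  "x \<in> obj P \<Longrightarrow> y \<in> obj P \<Longrightarrow> u \<in> carrier B \<Longrightarrow> xt C x (xt C y u) = xt C (tenO P x y) u"
  by (rule to_arr_inj) (simp add: to_arr_xt A.m_assoc A.inv_mult_group flip: idt_arr_mult)

lemma xt_unt: "u \<in> carrier B \<Longrightarrow> xt C (unt P) u = u"
  by (rule to_arr_inj) (simp add: to_arr_xt flip: arr_simps(3))

lemma peiffer:
  assumes "u \<in> carrier B" "v \<in> carrier B"
  shows "xt C (fst u) v = u \<otimes>\<^bsub>B\<^esub> v \<otimes>\<^bsub>B\<^esub> inv\<^bsub>B\<^esub> u"
proof -
  \<comment> \<open>\<open>k\<close> has source \<open>1\<close> and \<open>j v\<close> has target \<open>1\<close>, so their two composites show that they commute\<close>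
  let ?k = "inv\<^bsub>A\<^esub> (i (fst u)) \<otimes>\<^bsub>A\<^esub> j u"
  have k: "?k \<in> carrier A" using assms by simp
  have "fst ?k = unt P" using assms by (simp add: A_hom A_inv_hom) (simp add: to_arr_def)
  then obtain y h where h: "?k = (unt P, y, h)" by (metis prod.exhaust_sel)
  obtain x b where v: "v = (x, b)" by (cases v)
  have "h \<in> mor P (unt P) y" "b \<in> mor P x (unt P)"
    using k h assms v by (auto simp: arr_simps carrier_B to_arr_def)
  then have "j v \<otimes>\<^bsub>A\<^esub> ?k = ?k \<otimes>\<^bsub>A\<^esub> j v"
    using cmp_arr[of b x "unt P" h y] k h assms v
    by (simp add: to_arr_def[of P "(x, b)"] arr_mem flip: arr_simps(3))
  then have "j u \<otimes>\<^bsub>A\<^esub> j v = i (fst u) \<otimes>\<^bsub>A\<^esub> (j v \<otimes>\<^bsub>A\<^esub> (inv\<^bsub>A\<^esub> (i (fst u)) \<otimes>\<^bsub>A\<^esub> j u))"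
    using assms by (simp add: A.m_assoc)
  then have "u \<otimes>\<^bsub>B\<^esub> v = xt C (fst u) v \<otimes>\<^bsub>B\<^esub> u"
    using assms by (intro to_arr_inj) (simp add: to_arr_mult to_arr_xt A.m_assoc)
  then show ?thesis using assms by (simp add: B.m_assoc)
qed

lemma crossed_module_xmod_of_gr: "crossed_module C"
proof -
  \<comment> \<open>The action of the inverse object is the inverse map.\<close>
  have bij: "bij_betw (xt C y) (carrier B) (carrier B)" if "y \<in> obj P" for y
    by (rule bij_betw_byWitness[where f' = "xt C (ob_inv P y)"])
       (use that in \<open>auto simp: xt_xt xt_unt\<close>)
  have ext_t: "xt C y \<in> extensional (carrier B)" if "y \<in> obj P" for y
    using that by (simp add: xmod_of_gr_def)
  have "xt C y \<in> carrier (AutoGroup B)" if "y \<in> obj P" for y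
    using bij[OF that] ext_t[OF that] that
    by (auto simp: AutoGroup_def auto_def Bij_def hom_def xt_mult)
  \<comment> \<open>The product of \<open>AutoGroup\<close> is composition restricted to the
    carrier. Both sides are extensional, so they are compared on \<open>carrier B\<close>
    only.\<close>
  moreover have "xt C (tenO P x y) = xt C x \<otimes>\<^bsub>AutoGroup B\<^esub> xt C y" if "x \<in> obj P" "y \<in> obj P" for x y
    using that bij ext_t
    by (intro extensionalityI[of _ "carrier B"])
       (auto simp: AutoGroup_def BijGroup_def Bij_def xt_xt compose_def)
  ultimately have "xt C \<in> hom (obj_group P) (AutoGroup B)"
    by (auto simp: hom_def)
  moreover have "xd C \<in> hom B (obj_group P)"
    using B.m_closed
    by (auto simp: hom_def) (auto simp: xmod_of_gr_def)
  moreover have "fst (xt C x b) = tenO P (tenO P x (fst b)) (ob_inv P x)"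
    if "x \<in> obj P" "b \<in> carrier B" for x b
    using that by (simp add: xmod_of_gr_def)
  moreover have "extensional_op B" "xd C \<in> extensional (carrier B)" "xt C \<in> extensional (obj P)"
    by (simp_all add: extensional_op_def xmod_of_gr_def)
  moreover have "extensional_op (obj_group P)"
    using ext by (simp add: extensional_op_def smcat_extensional_def)
  ultimately show ?thesis
    unfolding crossed_module_def using group_B group_obj peiffer by simp
qed

section \<open>Coherence equations as equations in \<open>B\<close>\<close>

lemma xt_one [simp]: "y \<in> obj P \<Longrightarrow> xt C y \<one>\<^bsub>B\<^esub> = \<one>\<^bsub>B\<^esub>"
  by (rule to_arr_inj) (simp add: to_arr_xt)

lemma xt_inv:
  assumes "y \<in> obj P" "u \<in> carrier B"
  shows "xt C y (inv\<^bsub>B\<^esub> u) = inv\<^bsub>B\<^esub> (xt C y u)"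
  by (rule B.inv_equality[symmetric]) (use assms in \<open>simp_all flip: xt_mult\<close>)

lemma fst_mult [simp]:
  "u \<in> carrier B \<Longrightarrow> v \<in> carrier B \<Longrightarrow> fst (u \<otimes>\<^bsub>B\<^esub> v) = tenO P (fst u) (fst v)"
  by (simp add: xmod_of_gr_def)

lemma fst_one [simp]: "fst \<one>\<^bsub>B\<^esub> = unt P"
  by (simp add: xmod_of_gr_def)

lemma fst_inv [simp]: "u \<in> carrier B \<Longrightarrow> fst (inv\<^bsub>B\<^esub> u) = ob_inv P (fst u)"
  using fst_mult[of "inv\<^bsub>B\<^esub> u" u] by (simp add: D.inv_equality)

text \<open>The Peiffer identity at an element with trivial \<open>d\<close>: conjugation by
  \<open>u\<close> is then the action of the unit object.\<close>

lemma ker_central: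
  "u \<in> carrier B \<Longrightarrow> fst u = unt P \<Longrightarrow> v \<in> carrier B \<Longrightarrow> u \<otimes>\<^bsub>B\<^esub> v = v \<otimes>\<^bsub>B\<^esub> u"
  using peiffer[of u v] by (simp add: xt_unt B.inv_solve_right)

text \<open>Ends such as \<open>fo F (tenO P x y)\<close> are only provably equal to a tensor
  product and do not match the plain rule syntactically. Here the match is left to the simplifier as
  equations.\<close>

lemma tenM_mor' [simp]:
  "a = tenO P x x' \<Longrightarrow> b = tenO P y y' \<Longrightarrow> f \<in> mor P x y \<Longrightarrow> f' \<in> mor P x' y' \<Longrightarrow>
   tenM P x y x' y' f f' \<in> mor P a b"
  by (simp add: tenM_mor)

lemma as_element_ten' [simp]:
  "f \<in> mor P x y \<Longrightarrow> f' \<in> mor P x' y' \<Longrightarrow> a = tenO P x x' \<Longrightarrow> b = tenO P y y' \<Longrightarrow>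
   e a b (tenM P x y x' y' f f') = e x y f \<otimes>\<^bsub>B\<^esub> xt C y (e x' y' f')"
  by simp

text \<open>The two paths may pass through different middle objects; in \<open>B\<close> only the
  products of the elements remain. Coherence squares are verified below by this rule.\<close>

lemma cmp_eqI:
  assumes "f \<in> mor P x y" "g \<in> mor P y z" "f' \<in> mor P x' y'" "g' \<in> mor P y' z'" "x = x'" "z = z'"
    and "e x y f \<otimes>\<^bsub>B\<^esub> e y z g = e x' y' f' \<otimes>\<^bsub>B\<^esub> e y' z' g'"
  shows "cmp P x y z f g = cmp P x' y' z' f' g'"
  by (rule as_element_inj[of x z]) (use assms in auto)

lemma cmp_eq_idtI:
  assumes "f \<in> mor P x y" "g \<in> mor P y x" "e x y f \<otimes>\<^bsub>B\<^esub> e y x g = \<one>\<^bsub>B\<^esub>"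
  shows "cmp P x y x f g = idt P x"
  by (rule as_element_inj[of x x]) (use assms mor_obj in auto)

lemma as_element_unt: "u \<in> carrier B \<Longrightarrow> e (fst u) (unt P) (snd u) = u"
  using as_element_of_element[of u "fst u" "unt P"] by (simp add: of_element_def carrier_B to_arr_def arr_simps)

lemma snd_mor: "u \<in> carrier B \<Longrightarrow> snd u \<in> mor P (fst u) (unt P)"
  by (simp add: carrier_B to_arr_def arr_simps)

end

section \<open>Single Gr-functors\<close>

text \<open>Concerns \<open>fo\<close> and \<open>fm\<close> only and leaves \<open>ften\<close> and
  \<open>funt\<close> free. The unit object is then preserved because objects form a group.\<close>

definition strict_functor ::
  "('o, 'm) smcat \<Rightarrow> ('p, 'n) smcat \<Rightarrow> ('o, 'm, 'p, 'n) grfctr \<Rightarrow> bool" where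
  "strict_functor P Q F \<longleftrightarrow>
    is_functor P Q F \<and>
    (\<forall>x \<in> obj P. \<forall>y \<in> obj P. fo F (tenO P x y) = tenO Q (fo F x) (fo F y)) \<and>
    (\<forall>x y x' y'. \<forall>f \<in> mor P x y. \<forall>f' \<in> mor P x' y'.
       fm F (tenO P x x') (tenO P y y') (tenM P x y x' y' f f') =
       tenM Q (fo F x) (fo F y) (fo F x') (fo F y') (fm F x y f) (fm F x' y' f')) \<and>
    (\<forall>x. x \<notin> obj P \<longrightarrow> fo F x = undefined) \<and>
    (\<forall>x y f. f \<notin> mor P x y \<longrightarrow> fm F x y f = undefined)"

text \<open>Describes \<open>ften\<close> and \<open>funt\<close> by one element
  \<open>\<gamma>\<close> of the kernel of \<open>d\<close>. Hom-set membership is stated alongside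
  because \<open>as_element\<close> identifies an arrow only within its hom-set.\<close>

definition constant_constraint ::
  "('o, 'm) smcat \<Rightarrow> ('p, 'n) smcat \<Rightarrow> ('o, 'm, 'p, 'n) grfctr \<Rightarrow> 'p \<times> 'n \<Rightarrow> bool" where
  "constant_constraint P Q F \<gamma> \<longleftrightarrow>
    \<gamma> \<in> carrier (xB (xmod_of_gr Q)) \<and> fst \<gamma> = unt Q \<and>
    (\<forall>x \<in> obj P. xt (xmod_of_gr Q) (fo F x) \<gamma> = \<gamma>) \<and>
    (\<forall>x \<in> obj P. \<forall>y \<in> obj P. ften F x y \<in> mor Q (fo F (tenO P x y)) (fo F (tenO P x y)) \<and>
       as_element Q (fo F (tenO P x y)) (fo F (tenO P x y)) (ften F x y) = \<gamma>) \<and>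
    (\<forall>x y. \<not> (x \<in> obj P \<and> y \<in> obj P) \<longrightarrow> ften F x y = undefined) \<and>
    funt F \<in> mor Q (unt Q) (unt Q) \<and>
    as_element Q (unt Q) (unt Q) (funt F) = inv\<^bsub>xB (xmod_of_gr Q)\<^esub> \<gamma>"

text \<open>For a strict \<open>F\<close> this is the induced homomorphism between the groups
  \<open>B\<close>, the component \<open>f1\<close> of a morphism of crossed modules.\<close>

definition element_map ::
  "('o, 'm) smcat \<Rightarrow> ('o, 'm, 'p, 'n) grfctr \<Rightarrow> 'o \<times> 'm \<Rightarrow> 'p \<times> 'n" where
  "element_map P F u = (fo F (fst u), fm F (fst u) (unt P) (snd u))"

locale strict_Gr_pair = P: strict_Gr P + Q: strict_Gr Q
  for P :: "('o, 'm) smcat" and Q :: "('p, 'n) smcat"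
begin

section \<open>Strict functors and the maps they induce on \<open>B\<close>\<close>

context
  fixes F
  assumes F: "strict_functor P Q F"
begin

lemma fo_obj [simp]: "x \<in> obj P \<Longrightarrow> fo F x \<in> obj Q"
  using F by (simp add: strict_functor_def is_functor_def)

lemma fm_mor [simp]: "f \<in> mor P x y \<Longrightarrow> fm F x y f \<in> mor Q (fo F x) (fo F y)"
  using F P.mor_obj by (simp add: strict_functor_def is_functor_def)

lemma fm_idt [simp]: "x \<in> obj P \<Longrightarrow> fm F x x (idt P x) = idt Q (fo F x)"
  using F by (simp add: strict_functor_def is_functor_def)

lemma fm_cmp [simp]:
  "f \<in> mor P x y \<Longrightarrow> g \<in> mor P y z \<Longrightarrow>
   fm F x z (cmp P x y z f g) = cmp Q (fo F x) (fo F y) (fo F z) (fm F x y f) (fm F y z g)"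
  using F P.mor_obj[of f x y] P.mor_obj[of g y z] by (simp add: strict_functor_def is_functor_def)

lemma fo_ten [simp]:
  "x \<in> obj P \<Longrightarrow> y \<in> obj P \<Longrightarrow> fo F (tenO P x y) = tenO Q (fo F x) (fo F y)"
  using F by (simp add: strict_functor_def)

lemma fm_ten [simp]:
  "f \<in> mor P x y \<Longrightarrow> f' \<in> mor P x' y' \<Longrightarrow>
   a = tenO P x x' \<Longrightarrow> b = tenO P y y' \<Longrightarrow>
   fm F a b (tenM P x y x' y' f f') =
       tenM Q (fo F x) (fo F y) (fo F x') (fo F y') (fm F x y f) (fm F x' y' f')"
  using F by (simp add: strict_functor_def)

text \<open>The image of the unit is idempotent, and a group has only one idempotent.\<close>

lemma fo_unt [simp]: "fo F (unt P) = unt Q"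
proof -
  have "tenO Q (fo F (unt P)) (fo F (unt P)) = fo F (unt P)"
    by (simp flip: fo_ten)
  then show ?thesis by (metis Q.D.r_cancel_one fo_obj P.unt_obj)
qed

lemma fo_inv: "x \<in> obj P \<Longrightarrow> fo F (ob_inv P x) = ob_inv Q (fo F x)"
  by (rule Q.D.inv_equality[symmetric]) (simp_all flip: fo_ten)

abbreviation \<phi> where "\<phi> \<equiv> element_map P F"

text \<open>A strict \<open>F\<close> commutes with tensoring by the identity of the inverse of
  \<open>y\<close>, which is how \<open>as_element\<close> is formed.\<close>

lemma as_element_fm: "f \<in> mor P x y \<Longrightarrow> Q.e (fo F x) (fo F y) (fm F x y f) = \<phi> (P.e x y f)"
  using P.mor_obj[of f x y] by (simp add: element_map_def) (simp add: as_element_def fo_inv)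

text \<open>Since \<open>u\<close> is the element of its own arrow \<open>snd u\<close>,
  \<open>as_element_fm\<close> presents \<open>\<phi> u\<close> as the element of an arrow of
  \<open>Q\<close>.\<close>

lemma element_map_mem [simp]: "u \<in> carrier P.B \<Longrightarrow> \<phi> u \<in> carrier Q.B"
  using P.as_element_unt[of u] P.snd_mor[of u] as_element_fm[of "snd u" "fst u" "unt P"]
  by (metis Q.as_element_mem fm_mor)

lemma element_map_mult:
  assumes "u \<in> carrier P.B" "v \<in> carrier P.B"
  shows "\<phi> (u \<otimes>\<^bsub>P.B\<^esub> v) = \<phi> u \<otimes>\<^bsub>Q.B\<^esub> \<phi> v"
  using assms P.snd_mor[of u] P.snd_mor[of v] element_map_mem[of u] element_map_mem[of v]
  by (simp add: element_map_def xmod_of_gr_def)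

lemma element_map_xt:
  assumes "u \<in> carrier P.B" "y \<in> obj P"
  shows "\<phi> (xt P.C y u) = xt Q.C (fo F y) (\<phi> u)"
  using assms P.snd_mor[of u] element_map_mem[of u]
  by (simp add: element_map_def xmod_of_gr_def fo_inv)

lemma fst_element_map [simp]: "fst (\<phi> u) = fo F (fst u)"
  by (simp add: element_map_def)

lemma element_map_inv: "u \<in> carrier P.B \<Longrightarrow> \<phi> (inv\<^bsub>P.B\<^esub> u) = inv\<^bsub>Q.B\<^esub> (\<phi> u)"
  using group_hom.hom_inv[of P.B Q.B \<phi> u]
  by (simp add: group_hom_def group_hom_axioms_def hom_def element_map_mult P.group_B Q.group_B)

end

section \<open>Single functors as strict functors with a constant constraint\<close>

lemma Gr_functorI:
  assumes F: "strict_functor P Q F" and c: "constant_constraint P Q F \<gamma>"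
  shows "Gr_functor P Q F" "single P Q F"
proof -
  note [simp] = fo_obj[OF F] fm_mor[OF F] fm_idt[OF F] fm_cmp[OF F] fo_ten[OF F]
    fm_ten[OF F] fo_unt[OF F]
  have \<gamma> [simp]: "\<gamma> \<in> carrier Q.B" "fst \<gamma> = unt Q" "\<And>x. x \<in> obj P \<Longrightarrow> xt Q.C (fo F x) \<gamma> = \<gamma>"
    using c by (simp_all add: constant_constraint_def)
  have T: "ften F x y \<in> mor Q (tenO Q (fo F x) (fo F y)) (tenO Q (fo F x) (fo F y))"
    "Q.e (tenO Q (fo F x) (fo F y)) (tenO Q (fo F x) (fo F y)) (ften F x y) = \<gamma>"
    if "x \<in> obj P" "y \<in> obj P" for x y
    using c that by (simp_all add: constant_constraint_def)
  have U: "funt F \<in> mor Q (unt Q) (unt Q)" "Q.e (unt Q) (unt Q) (funt F) = inv\<^bsub>Q.B\<^esub> \<gamma>"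
    using c by (simp_all add: constant_constraint_def)
  note [simp] = P.tenO_assoc Q.tenO_assoc
  have T': "ften F x y \<in> mor Q a b" "Q.e a b (ften F x y) = \<gamma>"
    if "x \<in> obj P" "y \<in> obj P" "a = tenO Q (fo F x) (fo F y)" "b = a" for x y a b
    using T that by simp_all
  note [simp] = T' U
  \<comment> \<open>Both tensor products have the same element, and the central
    \<open>\<gamma>\<close> moves past it.\<close>
  have nat: "cmp Q (tenO Q (fo F x) (fo F x')) (tenO Q (fo F y) (fo F y')) (fo F (tenO P y y'))
         (tenM Q (fo F x) (fo F y) (fo F x') (fo F y') (fm F x y f) (fm F x' y' f'))
         (ften F y y') =
       cmp Q (tenO Q (fo F x) (fo F x')) (fo F (tenO P x x')) (fo F (tenO P y y'))
         (ften F x x')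
         (fm F (tenO P x x') (tenO P y y') (tenM P x y x' y' f f'))"
    if "f \<in> mor P x y" "f' \<in> mor P x' y'" for x y x' y' f f'
    by (rule Q.cmp_eqI)
      (use that P.mor_obj[OF that(1)] P.mor_obj[OF that(2)] in \<open>simp_all add: Q.ker_central[of \<gamma>]\<close>)
  \<comment> \<open>In \<open>B\<close> the sides are \<open>\<gamma> \<gamma>\<close> and
    \<open>(\<theta> \<gamma>) \<gamma>\<close>, where \<open>\<theta>\<close> is the action of
    \<open>F x\<close>, which fixes \<open>\<gamma>\<close>.\<close>
  have assoc: "cmp Q (tenO Q (tenO Q (fo F x) (fo F y)) (fo F z))
              (tenO Q (fo F (tenO P x y)) (fo F z))
              (fo F (tenO P (tenO P x y) z))
         (tenM Q (tenO Q (fo F x) (fo F y)) (fo F (tenO P x y)) (fo F z) (fo F z)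
            (ften F x y) (idt Q (fo F z)))
         (ften F (tenO P x y) z) =
       cmp Q (tenO Q (fo F x) (tenO Q (fo F y) (fo F z)))
              (tenO Q (fo F x) (fo F (tenO P y z)))
              (fo F (tenO P x (tenO P y z)))
         (tenM Q (fo F x) (fo F x) (tenO Q (fo F y) (fo F z)) (fo F (tenO P y z))
            (idt Q (fo F x)) (ften F y z))
         (ften F x (tenO P y z))" if "x \<in> obj P" "y \<in> obj P" "z \<in> obj P" for x y z
    by (rule Q.cmp_eqI) (use that in simp_all)
  \<comment> \<open>Both conditions reduce to \<open>\<gamma>\<^sup>-\<^sup>1 \<gamma> = 1\<close>;
    in the second one the action of \<open>F x\<close> fixes the inverse as well.\<close>
  have unit: "cmp Q (fo F x) (tenO Q (fo F (unt P)) (fo F x)) (fo F x)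
         (tenM Q (unt Q) (fo F (unt P)) (fo F x) (fo F x) (funt F) (idt Q (fo F x)))
         (ften F (unt P) x) = idt Q (fo F x)"
       "cmp Q (fo F x) (tenO Q (fo F x) (fo F (unt P))) (fo F x)
         (tenM Q (fo F x) (fo F x) (unt Q) (fo F (unt P)) (idt Q (fo F x)) (funt F))
         (ften F x (unt P)) = idt Q (fo F x)" if "x \<in> obj P" for x
    by (rule Q.cmp_eq_idtI; use that in \<open>simp add: Q.xt_inv\<close>)+
  have iso: "is_iso Q (tenO Q (fo F x) (fo F y)) (fo F (tenO P x y)) (ften F x y)"
    if "x \<in> obj P" "y \<in> obj P" for x y
    using that by (intro Q.mor_iso) simp
  have iso_unt: "is_iso Q (unt Q) (fo F (unt P)) (funt F)"
    by (intro Q.mor_iso) simp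
  have is_fun: "is_functor P Q F" using F by (simp add: strict_functor_def)
  have extn: "\<And>x. x \<notin> obj P \<Longrightarrow> fo F x = undefined"
    "\<And>x y f. f \<notin> mor P x y \<Longrightarrow> fm F x y f = undefined"
    "\<And>x y. \<not> (x \<in> obj P \<and> y \<in> obj P) \<Longrightarrow> ften F x y = undefined"
    using F c by (simp_all add: strict_functor_def constant_constraint_def)
  show "Gr_functor P Q F"
    unfolding Gr_functor_def
    by (intro conjI ballI allI impI; ((rule nat assoc unit iso extn; assumption) | fact))
  have "snd \<gamma> \<in> mor Q (unt Q) (unt Q)"
    using Q.snd_mor[of \<gamma>] by simp
  moreover have "\<gamma> = (unt Q, snd \<gamma>)" by (simp add: prod_eq_iff)
  ultimately show "single P Q F"
    unfolding single_def using T by (intro exI[of _ "snd \<gamma>"]) (auto intro: Q.mor_iso)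
qed

lemma Gr_functorD:
  assumes G: "Gr_functor P Q F" and s: "single P Q F"
  shows "strict_functor P Q F" "\<exists>\<gamma>. constant_constraint P Q F \<gamma>"
proof -
  obtain c where c: "is_iso Q (unt Q) (unt Q) c"
    "\<And>x y. x \<in> obj P \<Longrightarrow> y \<in> obj P \<Longrightarrow>
       Q.e (tenO Q (fo F x) (fo F y)) (fo F (tenO P x y)) (ften F x y) = (unt Q, c)"
    using s unfolding single_def by blast
  define \<gamma> where "\<gamma> = (unt Q, c)"
  have fo [simp]: "fo F x \<in> obj Q" if "x \<in> obj P" for x
    using G that by (simp add: Gr_functor_def is_functor_def)
  have fm [simp]: "fm F x y f \<in> mor Q (fo F x) (fo F y)" if "f \<in> mor P x y" for x y f
    using G that P.mor_obj by (simp add: Gr_functor_def is_functor_def)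
  have \<gamma> [simp]: "\<gamma> \<in> carrier Q.B" "fst \<gamma> = unt Q"
    using c(1) by (simp_all add: \<gamma>_def is_iso_def Q.carrier_B to_arr_def Q.arr_simps)
  \<comment> \<open>The first component of \<open>as_element\<close> is the source times the inverse
    of the target. Being the unit object here, it forces source and target of the constraint to
    coincide.\<close>
  have fo_ten [simp]: "fo F (tenO P x y) = tenO Q (fo F x) (fo F y)"
    if "x \<in> obj P" "y \<in> obj P" for x y
  proof -
    have "tenO Q (tenO Q (fo F x) (fo F y)) (ob_inv Q (fo F (tenO P x y))) = unt Q"
      using arg_cong[OF c(2)[OF that], of fst] by simp
    then show ?thesis
      using that by (metis Q.D.inv_equality Q.D.inv_closed Q.D.inv_inv Q.tenO_obj P.tenO_obj fo)
  qed
  have [simp]: "fo F (unt P) = unt Q"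
  proof -
    have "tenO Q (fo F (unt P)) (fo F (unt P)) = fo F (unt P)"
      by (simp flip: fo_ten)
    then show ?thesis by (metis Q.D.r_cancel_one fo P.unt_obj)
  qed
  have T: "ften F x y \<in> mor Q (tenO Q (fo F x) (fo F y)) (tenO Q (fo F x) (fo F y))"
    "Q.e (tenO Q (fo F x) (fo F y)) (tenO Q (fo F x) (fo F y)) (ften F x y) = \<gamma>"
    if "x \<in> obj P" "y \<in> obj P" for x y
    using G c(2) that by (auto simp: Gr_functor_def is_iso_def \<gamma>_def)
  note [simp] = P.tenO_assoc Q.tenO_assoc
  have T': "ften F x y \<in> mor Q a b" "Q.e a b (ften F x y) = \<gamma>"
    if "x \<in> obj P" "y \<in> obj P" "a = tenO Q (fo F x) (fo F y)" "b = a" for x y a b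
    using T that by simp_all
  note [simp] = T'
  have U [simp]: "funt F \<in> mor Q (unt Q) (unt Q)"
    using G by (simp add: Gr_functor_def is_iso_def)
  \<comment> \<open>Naturality has \<open>\<gamma>\<close> on the right of one side and on the left
    of the other; by centrality it cancels.\<close>
  have fm_ten: "fm F (tenO P x x') (tenO P y y') (tenM P x y x' y' f f') =
       tenM Q (fo F x) (fo F y) (fo F x') (fo F y') (fm F x y f) (fm F x' y' f')"
    if f: "f \<in> mor P x y" "f' \<in> mor P x' y'" for x y x' y' f f'
  proof -
    have o [simp]: "x \<in> obj P" "y \<in> obj P" "x' \<in> obj P" "y' \<in> obj P"
      using f P.mor_obj by auto
    let ?l = "tenM Q (fo F x) (fo F y) (fo F x') (fo F y') (fm F x y f) (fm F x' y' f')"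
    let ?r = "fm F (tenO P x x') (tenO P y y') (tenM P x y x' y' f f')"
    let ?s = "tenO Q (fo F x) (fo F x')" and ?t = "tenO Q (fo F y) (fo F y')"
    have m: "?l \<in> mor Q ?s ?t" "?r \<in> mor Q ?s ?t"
      using f fm[of "tenM P x y x' y' f f'" "tenO P x x'" "tenO P y y'"] by simp_all
    have "cmp Q ?s ?t ?t ?l (ften F y y') = cmp Q ?s ?s ?t (ften F x x') ?r"
      using G f unfolding Gr_functor_def by simp
    from arg_cong[OF this, of "Q.e ?s ?t"]
    have "Q.e ?s ?t ?l \<otimes>\<^bsub>Q.B\<^esub> \<gamma> = \<gamma> \<otimes>\<^bsub>Q.B\<^esub> Q.e ?s ?t ?r"
      using m by (simp del: Q.as_element_ten Q.as_element_ten')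
    then have "Q.e ?s ?t ?l = Q.e ?s ?t ?r"
      using m Q.ker_central[of \<gamma> "Q.e ?s ?t ?r"] by (simp del: Q.as_element_ten Q.as_element_ten')
    then show ?thesis using m Q.as_element_inj by metis
  qed
  show F: "strict_functor P Q F"
    using G fm_ten by (auto simp: strict_functor_def Gr_functor_def)
  \<comment> \<open>Associativity at \<open>x, x, x\<close> reads
    \<open>\<gamma> \<gamma> = (\<theta> \<gamma>) \<gamma>\<close>, where \<open>\<theta>\<close>
    is the action of \<open>F x\<close>, and one factor cancels.\<close>
  have inv: "xt Q.C (fo F x) \<gamma> = \<gamma>" if [simp]: "x \<in> obj P" for x
  proof -
    let ?x = "fo F x" and ?xx = "tenO Q (fo F x) (tenO Q (fo F x) (fo F x))"
    have "cmp Q ?xx ?xx ?xx (tenM Q (tenO Q ?x ?x) (tenO Q ?x ?x) ?x ?x (ften F x x) (idt Q ?x))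
        (ften F (tenO P x x) x)
      = cmp Q ?xx ?xx ?xx (tenM Q ?x ?x (tenO Q ?x ?x) (tenO Q ?x ?x) (idt Q ?x) (ften F x x))
        (ften F x (tenO P x x))"
      using G unfolding Gr_functor_def by simp
    from arg_cong[OF this, of "Q.e ?xx ?xx"] show ?thesis by simp
  qed
  \<comment> \<open>The unit condition at the unit object exhibits \<open>funt F\<close> as an
    inverse of the constraint.\<close>
  have "cmp Q (unt Q) (unt Q) (unt Q) (funt F) (ften F (unt P) (unt P)) = idt Q (unt Q)"
    using G unfolding Gr_functor_def by (auto dest!: bspec[of _ _ "unt P"])
  from arg_cong[OF this, of "Q.e (unt Q) (unt Q)"]
  have "Q.e (unt Q) (unt Q) (funt F) = inv\<^bsub>Q.B\<^esub> \<gamma>"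
    by (simp add: Q.B.inv_equality)
  then have "constant_constraint P Q F \<gamma>"
    using G T inv by (simp add: constant_constraint_def Gr_functor_def)
  then show "\<exists>\<gamma>. constant_constraint P Q F \<gamma>" ..
qed

text \<open>The content is the backward direction, where a homotopy between different constants has
  to be found. It makes strong homotopy blind to the constraints, from which equivalence and
  congruence follow easily.\<close>

lemma strong_homotopic_single_iff:
  assumes "Gr_functor P Q F" "single P Q F" "Gr_functor P Q G" "single P Q G"
  shows "strong_homotopic P Q F G \<longleftrightarrow> fo F = fo G \<and> fm F = fm G"
proof
  assume eq: "fo F = fo G \<and> fm F = fm G"
  note F = Gr_functorD(1)[OF assms(1,2)]
  obtain \<gamma> \<delta> where c: "constant_constraint P Q F \<gamma>" "constant_constraint P Q G \<delta>"
    using assms Gr_functorD(2) by meson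
  \<comment> \<open>The unit condition
    \<open>\<gamma>\<^sup>-\<^sup>1 b = \<delta>\<^sup>-\<^sup>1\<close> leaves only this
    value.\<close>
  let ?b = "\<gamma> \<otimes>\<^bsub>Q.B\<^esub> inv\<^bsub>Q.B\<^esub> \<delta>"
  define \<alpha> where "\<alpha> x = of_element Q (fo F x) ?b" for x
  note [simp] = fo_obj[OF F] fm_mor[OF F] fm_idt[OF F] fm_cmp[OF F] fo_ten[OF F]
    fm_ten[OF F] fo_unt[OF F]
  note fo = fo_obj[OF F] fo_ten[OF F] fo_unt[OF F]
  have [simp]: "fo G = fo F" "fm G = fm F" using eq by simp_all
  have m [simp]: "\<gamma> \<in> carrier Q.B" "fst \<gamma> = unt Q" "\<And>x. x \<in> obj P \<Longrightarrow> xt Q.C (fo F x) \<gamma> = \<gamma>"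
    "\<delta> \<in> carrier Q.B" "fst \<delta> = unt Q" "\<And>x. x \<in> obj P \<Longrightarrow> xt Q.C (fo F x) \<delta> = \<delta>"
    using c by (simp_all add: constant_constraint_def)
  have T [simp]: "ften F x y \<in> mor Q (tenO Q (fo F x) (fo F y)) (tenO Q (fo F x) (fo F y))"
    "Q.e (tenO Q (fo F x) (fo F y)) (tenO Q (fo F x) (fo F y)) (ften F x y) = \<gamma>"
    "ften G x y \<in> mor Q (tenO Q (fo F x) (fo F y)) (tenO Q (fo F x) (fo F y))"
    "Q.e (tenO Q (fo F x) (fo F y)) (tenO Q (fo F x) (fo F y)) (ften G x y) = \<delta>"
    if "x \<in> obj P" "y \<in> obj P" for x y
    using c that by (simp_all add: constant_constraint_def)
  have U [simp]: "funt F \<in> mor Q (unt Q) (unt Q)" "Q.e (unt Q) (unt Q) (funt F) = inv\<^bsub>Q.B\<^esub> \<gamma>"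
    "funt G \<in> mor Q (unt Q) (unt Q)" "Q.e (unt Q) (unt Q) (funt G) = inv\<^bsub>Q.B\<^esub> \<delta>"
    using c by (simp_all add: constant_constraint_def)
  have b [simp]: "?b \<in> carrier Q.B" "fst ?b = unt Q" "\<And>x. x \<in> obj P \<Longrightarrow> xt Q.C (fo F x) ?b = ?b"
    by (simp_all add: Q.xt_mult Q.xt_inv)
  have \<alpha> [simp]: "\<alpha> x \<in> mor Q a a" "Q.e a a (\<alpha> x) = ?b" if "x \<in> obj P" "a = fo F x" for x a
    using that unfolding \<alpha>_def by (simp_all add: Q.of_element_mor Q.as_element_of_element del: Q.fst_mult)
  have "cmp Q (fo F x) (fo F y) (fo F y) (fm F x y f) (\<alpha> y) =
     cmp Q (fo F x) (fo F x) (fo F y) (\<alpha> x) (fm F x y f)" if "f \<in> mor P x y" for x y f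
    by (rule Q.cmp_eqI) (use that P.mor_obj[OF that] Q.ker_central[of ?b] in simp_all)
  \<comment> \<open>In \<open>B\<close> this is \<open>b b \<delta> = \<gamma> b\<close>, which
    holds since \<open>b \<delta> = \<gamma>\<close> and kernel elements are central.\<close>
  moreover have "cmp Q (tenO Q (fo F x) (fo F y)) (tenO Q (fo G x) (fo G y)) (fo G (tenO P x y))
         (tenM Q (fo F x) (fo G x) (fo F y) (fo G y) (\<alpha> x) (\<alpha> y)) (ften G x y) =
       cmp Q (tenO Q (fo F x) (fo F y)) (fo F (tenO P x y)) (fo G (tenO P x y))
         (ften F x y) (\<alpha> (tenO P x y))" if "x \<in> obj P" "y \<in> obj P" for x y
    by (rule Q.cmp_eqI)
       (use that Q.ker_central[of ?b \<gamma>] in \<open>simp_all add: Q.B.m_assoc\<close>)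
  moreover have "cmp Q (unt Q) (unt Q) (unt Q) (funt F) (\<alpha> (unt P)) = funt G"
    by (rule Q.as_element_inj[of "unt Q" "unt Q"]) (simp_all flip: Q.B.m_assoc)
  ultimately have "homotopic P Q F G"
    unfolding homotopic_def by (intro exI[of _ \<alpha>]) (auto intro!: Q.mor_iso)
  then show "strong_homotopic P Q F G" using eq by (simp add: strong_homotopic_def)
qed (simp add: strong_homotopic_def)

text \<open>The case \<open>\<gamma> = 1\<close> of \<open>Gr_functorI\<close>. It supplies the
  identity functors, \<open>gr_ident\<close> and its inverse, and the representatives of strong
  homotopy classes.\<close>

lemma strict_Gr_functorI:
  assumes F: "strict_functor P Q F"
    and T: "\<And>x y. x \<in> obj P \<Longrightarrow> y \<in> obj P \<Longrightarrow> ften F x y = idt Q (fo F (tenO P x y))"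
    and E: "\<And>x y. \<not> (x \<in> obj P \<and> y \<in> obj P) \<Longrightarrow> ften F x y = undefined"
    and U: "funt F = idt Q (unt Q)"
  shows "Gr_functor P Q F" "single P Q F"
proof -
  have "constant_constraint P Q F \<one>\<^bsub>Q.B\<^esub>"
    using T E U by (auto simp: constant_constraint_def fo_obj[OF F])
  then show "Gr_functor P Q F" "single P Q F" using F Gr_functorI by blast+
qed

end

section \<open>The Gr-category of a crossed module\<close>

locale xmod =
  fixes X :: "('b, 'd) xmod"
  assumes xm: "crossed_module X"
begin

abbreviation G where "G \<equiv> gr_of_xmod X"

sublocale B: group "xB X" using xm by (simp add: crossed_module_def)
sublocale D: group "xD X" using xm by (simp add: crossed_module_def)

lemma d_hom: "xd X \<in> hom (xB X) (xD X)"
  using xm by (simp add: crossed_module_def)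

sublocale d: group_hom "xB X" "xD X" "xd X"
  by unfold_locales (rule d_hom)

lemma t_auto:
  "x \<in> carrier (xD X) \<Longrightarrow> xt X x \<in> hom (xB X) (xB X) \<inter> Bij (carrier (xB X))"
  using xm by (force simp: crossed_module_def hom_def[of "xD X"] AutoGroup_def auto_def)

lemma t_mem [simp]:
  "x \<in> carrier (xD X) \<Longrightarrow> b \<in> carrier (xB X) \<Longrightarrow> xt X x b \<in> carrier (xB X)"
  using t_auto by (auto simp: hom_def)

lemma t_mult [simp]:
  "x \<in> carrier (xD X) \<Longrightarrow> b \<in> carrier (xB X) \<Longrightarrow> c \<in> carrier (xB X) \<Longrightarrow>
   xt X x (b \<otimes>\<^bsub>xB X\<^esub> c) = xt X x b \<otimes>\<^bsub>xB X\<^esub> xt X x c"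
  using t_auto by (auto simp: hom_def)

lemma t_t:
  assumes "x \<in> carrier (xD X)" "y \<in> carrier (xD X)" "b \<in> carrier (xB X)"
  shows "xt X (x \<otimes>\<^bsub>xD X\<^esub> y) b = xt X x (xt X y b)"
proof -
  have "xt X (x \<otimes>\<^bsub>xD X\<^esub> y) = xt X x \<otimes>\<^bsub>AutoGroup (xB X)\<^esub> xt X y"
    using xm assms by (simp add: crossed_module_def hom_def)
  then show ?thesis
    using assms t_auto by (simp add: AutoGroup_def BijGroup_def compose_def)
qed

lemma t_one [simp]: "x \<in> carrier (xD X) \<Longrightarrow> xt X x \<one>\<^bsub>xB X\<^esub> = \<one>\<^bsub>xB X\<^esub>"
  by (metis B.l_cancel_one B.one_closed B.r_one t_mem t_mult)

text \<open>The action of 1 is injective and idempotent, hence the identity.\<close>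

lemma one_t [simp]:
  assumes "b \<in> carrier (xB X)" shows "xt X \<one>\<^bsub>xD X\<^esub> b = b"
proof -
  have "inj_on (xt X \<one>\<^bsub>xD X\<^esub>) (carrier (xB X))"
    using t_auto[of "\<one>\<^bsub>xD X\<^esub>"] by (auto simp: Bij_def bij_betw_def)
  then show ?thesis
    using t_t[of "\<one>\<^bsub>xD X\<^esub>" "\<one>\<^bsub>xD X\<^esub>" b] assms by (simp add: inj_on_eq_iff)
qed

lemma peiffer:
  "b \<in> carrier (xB X) \<Longrightarrow> c \<in> carrier (xB X) \<Longrightarrow>
   xt X (xd X b) c = b \<otimes>\<^bsub>xB X\<^esub> c \<otimes>\<^bsub>xB X\<^esub> inv\<^bsub>xB X\<^esub> b"
  using xm by (simp add: crossed_module_def)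

lemma d_t [simp]:
  "x \<in> carrier (xD X) \<Longrightarrow> b \<in> carrier (xB X) \<Longrightarrow>
   xd X (xt X x b) = x \<otimes>\<^bsub>xD X\<^esub> xd X b \<otimes>\<^bsub>xD X\<^esub> inv\<^bsub>xD X\<^esub> x"
  using xm by (simp add: crossed_module_def)

section \<open>The strict Gr-category axioms for \<open>gr_of_xmod X\<close>\<close>

lemma gr_mor_iff:
  "b \<in> gr_mor X x y \<longleftrightarrow>
   b \<in> carrier (xB X) \<and> y \<in> carrier (xD X) \<and> x = xd X b \<otimes>\<^bsub>xD X\<^esub> y"
  by (auto simp: gr_mor_def)

lemma mult_undefined:
  "\<not> (b \<in> carrier (xB X) \<and> c \<in> carrier (xB X)) \<Longrightarrow> b \<otimes>\<^bsub>xB X\<^esub> c = undefined"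
  "\<not> (x \<in> carrier (xD X) \<and> y \<in> carrier (xD X)) \<Longrightarrow> x \<otimes>\<^bsub>xD X\<^esub> y = undefined"
  using xm by (simp_all add: crossed_module_def extensional_op_def)

lemma gr_simps [simp]:
  "obj G = carrier (xD X)" "mor G = gr_mor X" "tenO G = mult (xD X)" "unt G = \<one>\<^bsub>xD X\<^esub>"
  "x \<in> carrier (xD X) \<Longrightarrow> idt G x = \<one>\<^bsub>xB X\<^esub>"
  by (simp_all add: gr_of_xmod_def)

lemma gr_cmp [simp]:
  "b \<in> gr_mor X x y \<Longrightarrow> c \<in> gr_mor X y z \<Longrightarrow> cmp G x y z b c = b \<otimes>\<^bsub>xB X\<^esub> c"
  by (simp add: gr_of_xmod_def)

lemma gr_tenM [simp]:
  "b \<in> gr_mor X x y \<Longrightarrow> b' \<in> gr_mor X x' y' \<Longrightarrow>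
   tenM G x y x' y' b b' = b \<otimes>\<^bsub>xB X\<^esub> xt X y b'"
  by (simp add: gr_of_xmod_def)

lemma gr_idt_mor [simp]: "x \<in> carrier (xD X) \<Longrightarrow> \<one>\<^bsub>xB X\<^esub> \<in> gr_mor X x x"
  by (simp add: gr_mor_iff)

lemma gr_cmp_mor [simp]:
  "b \<in> gr_mor X x y \<Longrightarrow> c \<in> gr_mor X y z \<Longrightarrow> b \<otimes>\<^bsub>xB X\<^esub> c \<in> gr_mor X x z"
  by (auto simp: gr_mor_iff D.m_assoc)

lemma gr_ten_mor [simp]:
  "b \<in> gr_mor X x y \<Longrightarrow> b' \<in> gr_mor X x' y' \<Longrightarrow>
   b \<otimes>\<^bsub>xB X\<^esub> xt X y b' \<in> gr_mor X (x \<otimes>\<^bsub>xD X\<^esub> x') (y \<otimes>\<^bsub>xD X\<^esub> y')"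
  by (auto simp: gr_mor_iff D.m_assoc D.inv_solve_left simp flip: D.m_assoc[of "inv\<^bsub>xD X\<^esub> y"])

text \<open>As \<open>y = d(c) z\<close>, the Peiffer identity turns the action of \<open>y\<close>
  on \<open>b'\<close> into the action of \<open>z\<close> followed by conjugation by
  \<open>c\<close>, which moves \<open>c\<close> across.\<close>

lemma gr_interchange:
  assumes "b \<in> gr_mor X x y" "c \<in> gr_mor X y z" "b' \<in> gr_mor X x' y'" "c' \<in> gr_mor X y' z'"
  shows "b \<otimes>\<^bsub>xB X\<^esub> c \<otimes>\<^bsub>xB X\<^esub> xt X z (b' \<otimes>\<^bsub>xB X\<^esub> c') =
    b \<otimes>\<^bsub>xB X\<^esub> xt X y b' \<otimes>\<^bsub>xB X\<^esub> (c \<otimes>\<^bsub>xB X\<^esub> xt X z c')"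
proof -
  have [simp]: "y = xd X c \<otimes>\<^bsub>xD X\<^esub> z" "z \<in> carrier (xD X)" "b \<in> carrier (xB X)"
    "c \<in> carrier (xB X)" "b' \<in> carrier (xB X)" "c' \<in> carrier (xB X)"
    using assms by (auto simp: gr_mor_iff)
  have "inv\<^bsub>xB X\<^esub> c \<otimes>\<^bsub>xB X\<^esub> (c \<otimes>\<^bsub>xB X\<^esub> xt X z c') = xt X z c'"
    by (simp flip: B.m_assoc)
  then show ?thesis by (simp add: t_t peiffer B.m_assoc)
qed

lemma strict_Gr_gr_of_xmod: "strict_Gr_category G"
proof -
  have "category G"
    unfolding category_def by (auto simp: gr_mor_iff[symmetric]) (auto simp: gr_mor_iff B.m_assoc)
  \<comment> \<open>Both sides are \<open>f\<close> times the action of \<open>y\<close> on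
    \<open>f'\<close> times the action of \<open>y y'\<close> on \<open>f''\<close>.\<close>
  moreover have "tenM G (x \<otimes>\<^bsub>xD X\<^esub> x') (y \<otimes>\<^bsub>xD X\<^esub> y') x'' y'' (tenM G x y x' y' f f') f'' =
       tenM G x y (x' \<otimes>\<^bsub>xD X\<^esub> x'') (y' \<otimes>\<^bsub>xD X\<^esub> y'') f (tenM G x' y' x'' y'' f' f'')"
    if "f \<in> gr_mor X x y" "f' \<in> gr_mor X x' y'" "f'' \<in> gr_mor X x'' y''" for x y x' y' x'' y'' f f' f''
    using that by simp (auto simp: gr_mor_iff B.m_assoc t_t)
  moreover have "tenM G (unt G) (unt G) x y (idt G (unt G)) f = f"
    "tenM G x y (unt G) (unt G) f (idt G (unt G)) = f" "f \<otimes>\<^bsub>xB X\<^esub> \<one>\<^bsub>xB X\<^esub> = f"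
    if "f \<in> gr_mor X x y" for x y f
    using that by (simp_all, simp_all add: gr_mor_iff)
  ultimately have "strict_monoidal_category G"
    unfolding strict_monoidal_category_def
    by (simp add: gr_interchange D.m_assoc)
  moreover have "is_iso G x y b" if b: "b \<in> gr_mor X x y" for x y b
  proof -
    have "inv\<^bsub>xB X\<^esub> b \<in> gr_mor X y x"
      using b by (simp add: gr_mor_iff flip: D.m_assoc)
    moreover have "b \<in> carrier (xB X)" "x \<in> carrier (xD X)" "y \<in> carrier (xD X)"
      using b by (auto simp: gr_mor_iff)
    ultimately show ?thesis
      unfolding is_iso_def using b by (intro conjI bexI[of _ "inv\<^bsub>xB X\<^esub> b"]) simp_all
  qed
  moreover have "\<exists>y \<in> obj G. tenO G x y = unt G \<and> tenO G y x = unt G" if "x \<in> obj G" for x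
    using that by (intro bexI[of _ "inv\<^bsub>xD X\<^esub> x"]) simp_all
  \<comment> \<open>The tensor product of objects is the product of \<open>xD X\<close>, which a
    crossed module requires to be undefined outside the carrier.\<close>
  moreover have "smcat_extensional G"
    unfolding smcat_extensional_def
    by (auto simp: gr_of_xmod_def gr_mor_def mult_undefined)
  ultimately show ?thesis by (simp add: strict_Gr_category_def)
qed

lemma gr_ob_inv: "ob_inv G x = inv\<^bsub>xD X\<^esub> x"
  by (simp add: m_inv_def obj_group_def)

sublocale G: strict_Gr G
  by unfold_locales (rule strict_Gr_gr_of_xmod)

lemma xmod_isomorphism_ident: "xmod_isomorphism X (xmod_of_gr G) (xmod_ident X)"
proof -
  \<comment> \<open>An arrow \<open>b\<close> into 1 has source \<open>d b\<close>, so the pairs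
    form the graph of \<open>d\<close> with its coordinates swapped.\<close>
  have c: "carrier (xB (xmod_of_gr G)) = (\<lambda>b. (xd X b, b)) ` carrier (xB X)"
    by (auto simp: xmod_of_gr_def xmod_carrier_def gr_mor_iff)
  have inm: "b \<in> gr_mor X (xd X b) \<one>\<^bsub>xD X\<^esub>" if "b \<in> carrier (xB X)" for b
    using that by (simp add: gr_mor_iff)
  have "(xd X b, b) \<otimes>\<^bsub>xB (xmod_of_gr G)\<^esub> (xd X c, c) = (xd X (b \<otimes>\<^bsub>xB X\<^esub> c), b \<otimes>\<^bsub>xB X\<^esub> c)"
    if "b \<in> carrier (xB X)" "c \<in> carrier (xB X)" for b c
    using that inm by (simp add: xmod_of_gr_def xmod_carrier_def)
  \<comment> \<open>Tensoring with the identity of \<open>x\<close> on the left applies the action;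
    tensoring with that of its inverse on the right changes the ends but not the element.\<close>
  moreover have "xt (xmod_of_gr G) x (xd X b, b) = (xd X (xt X x b), xt X x b)"
    if [simp]: "x \<in> carrier (xD X)" "b \<in> carrier (xB X)" for x b
  proof -
    have "tenM G x x (xd X b) \<one>\<^bsub>xD X\<^esub> \<one>\<^bsub>xB X\<^esub> b = xt X x b"
      using inm[of b] by simp
    moreover have "xt X x b \<in> gr_mor X (x \<otimes>\<^bsub>xD X\<^esub> xd X b) x"
      by (simp add: gr_mor_iff D.m_assoc)
    ultimately show ?thesis
      using inm[of b] by (simp add: xmod_of_gr_def xmod_carrier_def gr_ob_inv)
  qed
  moreover have "bij_betw (\<lambda>x \<in> carrier (xD X). x) (carrier (xD X)) (carrier (xD X))"
    by (rule bij_betwI[where g = "\<lambda>x. x"]) auto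
  moreover have "bij_betw (\<lambda>b \<in> carrier (xB X). (xd X b, b)) (carrier (xB X)) ((\<lambda>b. (xd X b, b)) ` carrier (xB X))"
    by (rule bij_betw_imageI[of "\<lambda>b \<in> carrier (xB X). (xd X b, b)", simplified]) (auto simp: inj_on_def)
  ultimately show ?thesis
    unfolding xmod_isomorphism_def xmod_morphism_def xmod_ident_def
    by (auto simp: c hom_def G.tenO_assoc)
qed

end

section \<open>Composition of single Gr-functors and strong homotopy classes\<close>

abbreviation single_Gr_functor where
  "single_Gr_functor P Q F \<equiv> Gr_functor P Q F \<and> single P Q F"

context strict_Gr_pair
begin

context
  fixes F
  assumes F: "single_Gr_functor P Q F"
begin

lemmas strict_of_single = Gr_functorD(1)[OF conjunct1[OF F] conjunct2[OF F]]

lemmas single_simps = fo_obj[OF strict_of_single] fm_mor[OF strict_of_single]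
  fm_idt[OF strict_of_single] fm_cmp[OF strict_of_single] fo_ten[OF strict_of_single]
  fm_ten[OF strict_of_single] fo_unt[OF strict_of_single]

lemma ften_mor:
  "x \<in> obj P \<Longrightarrow> y \<in> obj P \<Longrightarrow>
   ften F x y \<in> mor Q (tenO Q (fo F x) (fo F y)) (tenO Q (fo F x) (fo F y))"
  using F by (simp add: Gr_functor_def is_iso_def single_simps)

lemma funt_mor: "funt F \<in> mor Q (unt Q) (unt Q)"
  using F by (simp add: Gr_functor_def is_iso_def single_simps)

lemma single_undefined:
  "x \<notin> obj P \<Longrightarrow> fo F x = undefined"
  "f \<notin> mor P x y \<Longrightarrow> fm F x y f = undefined"
  "\<not> (x \<in> obj P \<and> y \<in> obj P) \<Longrightarrow> ften F x y = undefined"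
  using F by (simp_all add: Gr_functor_def)

lemma Gr_id_comp: "Gr_comp P P Q (Gr_id P) F = F"
  unfolding Gr_comp_def Gr_id_def
  by (rule grfctr.equality)
     (auto simp: fun_eq_iff single_undefined single_simps ften_mor funt_mor restrict_def
       dest: P.mor_obj)

lemma Gr_comp_id: "Gr_comp P Q Q F (Gr_id Q) = F"
  unfolding Gr_comp_def Gr_id_def
  by (rule grfctr.equality)
     (auto simp: fun_eq_iff single_undefined single_simps ften_mor funt_mor restrict_def
       dest: P.mor_obj)

end

end

section \<open>Composites of single functors\<close>

locale strict_Gr_triple = PQ: strict_Gr_pair P Q + QR: strict_Gr_pair Q R
  for P :: "('o, 'm) smcat" and Q :: "('p, 'n) smcat" and R :: "('q, 'k) smcat"
begin

sublocale PR: strict_Gr_pair P R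
  by unfold_locales

lemma strict_functor_comp:
  assumes F: "strict_functor P Q F" and G: "strict_functor Q R G"
  shows "strict_functor P R (Gr_comp P Q R F G)"
proof -
  note [simp] = PQ.fo_obj[OF F] PQ.fm_mor[OF F] PQ.fm_idt[OF F] PQ.fm_cmp[OF F] PQ.fo_ten[OF F]
    PQ.fm_ten[OF F] PQ.fo_unt[OF F]
    QR.fo_obj[OF G] QR.fm_mor[OF G] QR.fm_idt[OF G] QR.fm_cmp[OF G] QR.fo_ten[OF G]
    QR.fm_ten[OF G] QR.fo_unt[OF G]
  have "is_functor P R (Gr_comp P Q R F G)"
    by (simp add: is_functor_def Gr_comp_def)
  moreover have "fm (Gr_comp P Q R F G) (tenO P x x') (tenO P y y') (tenM P x y x' y' f f') =
       tenM R (fo (Gr_comp P Q R F G) x) (fo (Gr_comp P Q R F G) y) (fo (Gr_comp P Q R F G) x')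
         (fo (Gr_comp P Q R F G) y') (fm (Gr_comp P Q R F G) x y f)
         (fm (Gr_comp P Q R F G) x' y' f')"
    if "f \<in> mor P x y" "f' \<in> mor P x' y'" for x y x' y' f f'
    using that PQ.P.mor_obj[OF that(1)] PQ.P.mor_obj[OF that(2)] by (simp add: Gr_comp_def)
  ultimately show ?thesis
    by (simp add: strict_functor_def) (simp add: Gr_comp_def)
qed

text \<open>The composite constraint is that of \<open>G\<close> followed by the image of that of
  \<open>F\<close>, whence the product. The composite unit constraint has the inverses in the same
  order, which is correct because \<open>\<delta>\<close> is central. Invariance under the action
  uses that the induced map on \<open>B\<close> is equivariant.\<close>

lemma constant_constraint_comp:
  assumes F: "strict_functor P Q F" "constant_constraint P Q F \<gamma>"
    and G: "strict_functor Q R G" "constant_constraint Q R G \<delta>"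
  shows "constant_constraint P R (Gr_comp P Q R F G)
    (\<delta> \<otimes>\<^bsub>xB (xmod_of_gr R)\<^esub> element_map Q G \<gamma>)"
proof -
  note [simp] = PQ.fo_obj[OF F(1)] PQ.fo_ten[OF F(1)] PQ.fo_unt[OF F(1)]
    QR.fo_obj[OF G(1)] QR.fm_mor[OF G(1)] QR.fo_ten[OF G(1)] QR.fo_unt[OF G(1)]
    QR.element_map_mem[OF G(1)] QR.fst_element_map[OF G(1)]
  have m [simp]: "\<gamma> \<in> carrier PQ.Q.B" "fst \<gamma> = unt Q"
    "\<And>x. x \<in> obj P \<Longrightarrow> xt PQ.Q.C (fo F x) \<gamma> = \<gamma>"
    "\<delta> \<in> carrier QR.Q.B" "fst \<delta> = unt R" "\<And>x. x \<in> obj Q \<Longrightarrow> xt QR.Q.C (fo G x) \<delta> = \<delta>"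
    using F G by (simp_all add: constant_constraint_def)
  have c [simp]: "ften F x y \<in> mor Q (tenO Q (fo F x) (fo F y)) (tenO Q (fo F x) (fo F y))"
    "PQ.Q.e (tenO Q (fo F x) (fo F y)) (tenO Q (fo F x) (fo F y)) (ften F x y) = \<gamma>"
    if "x \<in> obj P" "y \<in> obj P" for x y
    using F that by (simp_all add: constant_constraint_def)
  have d [simp]: "ften G x y \<in> mor R (tenO R (fo G x) (fo G y)) (tenO R (fo G x) (fo G y))"
    "QR.Q.e (tenO R (fo G x) (fo G y)) (tenO R (fo G x) (fo G y)) (ften G x y) = \<delta>"
    if "x \<in> obj Q" "y \<in> obj Q" for x y
    using G that by (simp_all add: constant_constraint_def)
  have U: "funt F \<in> mor Q (unt Q) (unt Q)" "PQ.Q.e (unt Q) (unt Q) (funt F) = inv\<^bsub>PQ.Q.B\<^esub> \<gamma>"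
    "funt G \<in> mor R (unt R) (unt R)" "QR.Q.e (unt R) (unt R) (funt G) = inv\<^bsub>QR.Q.B\<^esub> \<delta>"
    using F G by (simp_all add: constant_constraint_def)
  have Gc [simp]: "fm G (tenO Q (fo F x) (fo F y)) (tenO Q (fo F x) (fo F y)) (ften F x y)
      \<in> mor R (tenO R (fo G (fo F x)) (fo G (fo F y))) (tenO R (fo G (fo F x)) (fo G (fo F y)))"
    "QR.Q.e (tenO R (fo G (fo F x)) (fo G (fo F y))) (tenO R (fo G (fo F x)) (fo G (fo F y)))
      (fm G (tenO Q (fo F x) (fo F y)) (tenO Q (fo F x) (fo F y)) (ften F x y)) = element_map Q G \<gamma>"
    if "x \<in> obj P" "y \<in> obj P" for x y
    using that QR.fm_mor[OF G(1) c(1)[OF that]] QR.as_element_fm[OF G(1) c(1)[OF that]] by simp_all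
  have Gu [simp]: "fm G (unt Q) (unt Q) (funt F) \<in> mor R (unt R) (unt R)"
    "QR.Q.e (unt R) (unt R) (fm G (unt Q) (unt Q) (funt F)) = inv\<^bsub>QR.Q.B\<^esub> (element_map Q G \<gamma>)"
    using QR.fm_mor[OF G(1) U(1)] QR.as_element_fm[OF G(1) U(1)] U(2) by (simp_all add: QR.element_map_inv[OF G(1)])
  have inv: "xt QR.Q.C (fo G (fo F x)) (element_map Q G \<gamma>) = element_map Q G \<gamma>" if "x \<in> obj P" for x
    using that by (simp flip: QR.element_map_xt[OF G(1)])
  show ?thesis
    unfolding constant_constraint_def Gr_comp_def
    using QR.Q.ker_central[of \<delta> "element_map Q G \<gamma>"]
    by (simp add: U QR.Q.xt_mult inv QR.Q.B.inv_mult_group)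
qed

lemma Gr_comp_closed:
  assumes F: "single_Gr_functor P Q F" and G: "single_Gr_functor Q R G"
  shows "single_Gr_functor P R (Gr_comp P Q R F G)"
  using assms PQ.Gr_functorD QR.Gr_functorD PR.Gr_functorI strict_functor_comp
    constant_constraint_comp by meson

end

text \<open>On constraints, \<open>H\<close> is distributed over a composite and the rest is
  associativity in \<open>S\<close>; the facts \<open>t\<close>, \<open>u\<close>,
  \<open>t'\<close>, \<open>u'\<close> provide the typing for this. The types of the categories are
  independent, since the law is also applied to \<open>gr_of_xmod (xmod_of_gr P)\<close>, whose
  arrows have another type than those of \<open>P\<close>.\<close>

lemma Gr_comp_assoc:
  assumes "strict_Gr_category P" "strict_Gr_category Q" "strict_Gr_category R" "strict_Gr_category S"
    and F: "single_Gr_functor P Q F" and G: "single_Gr_functor Q R G" and H: "single_Gr_functor R S H"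
  shows "Gr_comp P R S (Gr_comp P Q R F G) H = Gr_comp P Q S F (Gr_comp Q R S G H)"
proof -
  interpret PQ: strict_Gr_pair P Q using assms by unfold_locales
  interpret QR: strict_Gr_pair Q R using assms by unfold_locales
  interpret RS: strict_Gr_pair R S using assms by unfold_locales
  note [simp] = PQ.single_simps[OF F] QR.single_simps[OF G] RS.single_simps[OF H]
    PQ.ften_mor[OF F] QR.ften_mor[OF G] RS.ften_mor[OF H]
    PQ.funt_mor[OF F] QR.funt_mor[OF G] RS.funt_mor[OF H]
  have t: "fm G (tenO Q (fo F x) (fo F y)) (tenO Q (fo F x) (fo F y)) (ften F x y)
    \<in> mor R (tenO R (fo G (fo F x)) (fo G (fo F y))) (tenO R (fo G (fo F x)) (fo G (fo F y)))"
    if "x \<in> obj P" "y \<in> obj P" for x y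
    using that PQ.single_simps[OF F] QR.fm_mor[OF QR.strict_of_single[OF G] PQ.ften_mor[OF F that]] by simp
  have u: "fm G (unt Q) (unt Q) (funt F) \<in> mor R (unt R) (unt R)"
    using QR.fm_mor[OF QR.strict_of_single[OF G] PQ.funt_mor[OF F]] by simp
  have t': "fm H (tenO R (fo G x) (fo G y)) (tenO R (fo G x) (fo G y)) f
    \<in> mor S (tenO S (fo H (fo G x)) (fo H (fo G y))) (tenO S (fo H (fo G x)) (fo H (fo G y)))"
    if "x \<in> obj Q" "y \<in> obj Q" "f \<in> mor R (tenO R (fo G x) (fo G y)) (tenO R (fo G x) (fo G y))" for x y f
    using that RS.fm_mor[OF RS.strict_of_single[OF H] that(3)] by simp
  have u': "fm H (unt R) (unt R) f \<in> mor S (unt S) (unt S)" if "f \<in> mor R (unt R) (unt R)" for f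
    using RS.fm_mor[OF RS.strict_of_single[OF H] that] by simp
  show ?thesis
    unfolding Gr_comp_def
    by (rule grfctr.equality)
       (auto simp: fun_eq_iff restrict_def t u t' u' RS.Q.cmp_assoc dest: PQ.P.mor_obj)
qed

lemma single_Gr_functor_id:
  assumes "strict_Gr_category P" shows "single_Gr_functor P P (Gr_id P)"
proof -
  interpret strict_Gr_pair P P using assms by unfold_locales
  have "strict_functor P P (Gr_id P)"
    by (auto simp: strict_functor_def is_functor_def Gr_id_def restrict_def dest!: P.mor_obj)
  then show ?thesis
    by (intro conjI strict_Gr_functorI; (assumption | auto simp: Gr_id_def)?)
qed

lemma category_Grstr: "category Grstr"
proof -
  have "single_Gr_functor P R (Gr_comp P Q R F G)"
    if "strict_Gr_category P" "strict_Gr_category Q" "strict_Gr_category R"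
      "single_Gr_functor P Q F" "single_Gr_functor Q R G"
    for P Q R :: "('o, 'm) smcat" and F G
  proof -
    interpret strict_Gr_triple P Q R using that by unfold_locales
    show ?thesis using Gr_comp_closed that by blast
  qed
  moreover have "Gr_comp P P Q (Gr_id P) F = F \<and> Gr_comp P Q Q F (Gr_id Q) = F"
    if "strict_Gr_category P" "strict_Gr_category Q" "single_Gr_functor P Q F"
    for P Q :: "('o, 'm) smcat" and F
  proof -
    interpret strict_Gr_pair P Q using that by unfold_locales
    show ?thesis using Gr_id_comp Gr_comp_id that by blast
  qed
  ultimately show ?thesis
    unfolding category_def Grstr_def
    by (simp add: single_Gr_functor_id Gr_comp_assoc) blast
qed

section \<open>Quotient categories and the quotient by strong homotopy\<close>

lemma category_cmp:
  assumes "category C" "x \<in> obj C" "y \<in> obj C" "z \<in> obj C" "f \<in> mor C x y" "g \<in> mor C y z"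
  shows "cmp C x y z f g \<in> mor C x z"
  using assms by (simp add: category_def)

text \<open>By congruence all composites of representatives lie in one class, so the union in
  \<open>quotient_cat\<close> collapses to it. The union is not empty since \<open>f\<close> and
  \<open>g\<close> represent their own classes.\<close>

lemma quotient_cmp:
  assumes "category C" "\<And>x y. x \<in> obj C \<Longrightarrow> y \<in> obj C \<Longrightarrow> equiv (mor C x y) (R x y)"
    and "\<And>x y z f f' g g'. x \<in> obj C \<Longrightarrow> y \<in> obj C \<Longrightarrow> z \<in> obj C \<Longrightarrow>
      (f, f') \<in> R x y \<Longrightarrow> (g, g') \<in> R y z \<Longrightarrow> (cmp C x y z f g, cmp C x y z f' g') \<in> R x z"
    and "x \<in> obj C" "y \<in> obj C" "z \<in> obj C" "f \<in> mor C x y" "g \<in> mor C y z"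
  shows "cmp (quotient_cat C R) x y z (R x y `` {f}) (R y z `` {g}) = R x z `` {cmp C x y z f g}"
proof -
  have "R x z `` {cmp C x y z f' g'} = R x z `` {cmp C x y z f g}"
    if "f' \<in> R x y `` {f}" "g' \<in> R y z `` {g}" for f' g'
    using that assms equiv_class_eq[of "mor C x z" "R x z"] by (metis Image_singleton_iff)
  moreover have "f \<in> R x y `` {f}" "g \<in> R y z `` {g}"
    using assms by (meson equiv_class_self)+
  ultimately have "(\<Union>f'\<in>R x y `` {f}. \<Union>g'\<in>R y z `` {g}. R x z `` {cmp C x y z f' g'})
    = R x z `` {cmp C x y z f g}"
    by blast
  then show ?thesis by (simp add: quotient_cat_def)
qed

lemma category_quotient:
  assumes C: "category C" and equiv: "\<And>x y. x \<in> obj C \<Longrightarrow> y \<in> obj C \<Longrightarrow> equiv (mor C x y) (R x y)"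
    and cong: "\<And>x y z f f' g g'. x \<in> obj C \<Longrightarrow> y \<in> obj C \<Longrightarrow> z \<in> obj C \<Longrightarrow>
      (f, f') \<in> R x y \<Longrightarrow> (g, g') \<in> R y z \<Longrightarrow> (cmp C x y z f g, cmp C x y z f' g') \<in> R x z"
  shows "category (quotient_cat C R)"
proof -
  note q = quotient_cmp[of C R, OF C equiv cong]
  have o: "obj (quotient_cat C R) = obj C" "mor (quotient_cat C R) x y = mor C x y // R x y"
    "idt (quotient_cat C R) x = R x x `` {idt C x}" for x y
    by (simp_all add: quotient_cat_def)
  have idt: "idt C x \<in> mor C x x" if "x \<in> obj C" for x
    using C that by (simp add: category_def)
  have cmp: "cmp C x y z f g \<in> mor C x z"
    if "x \<in> obj C" "y \<in> obj C" "z \<in> obj C" "f \<in> mor C x y" "g \<in> mor C y z" for x y z f g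
    using C that by (simp add: category_def)
  have unit: "cmp C x x y (idt C x) f = f" "cmp C x y y f (idt C y) = f"
    if "x \<in> obj C" "y \<in> obj C" "f \<in> mor C x y" for x y f
    using C that by (simp_all add: category_def)
  have assoc: "cmp C w y z (cmp C w x y f g) h = cmp C w x z f (cmp C x y z g h)"
    if "w \<in> obj C" "x \<in> obj C" "y \<in> obj C" "z \<in> obj C"
      "f \<in> mor C w x" "g \<in> mor C x y" "h \<in> mor C y z" for w x y z f g h
    using C that by (simp add: category_def)
  show ?thesis
    unfolding category_def o
    by (auto simp: idt cmp unit assoc q elim!: quotientE intro!: quotientI)
qed

lemma strong_homotopy_iff:
  assumes "strict_Gr_category P" "strict_Gr_category Q"
  shows "(F, G) \<in> strong_homotopy P Q \<longleftrightarrow>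
    F \<in> mor Grstr P Q \<and> G \<in> mor Grstr P Q \<and> fo F = fo G \<and> fm F = fm G"
proof -
  interpret strict_Gr_pair P Q using assms by unfold_locales
  show ?thesis
    using strong_homotopic_single_iff by (auto simp: strong_homotopy_def Grstr_def)
qed

lemma equiv_strong_homotopy:
  assumes "strict_Gr_category P" "strict_Gr_category Q"
  shows "equiv (mor Grstr P Q) (strong_homotopy P Q)"
  by (rule equivI) (auto simp: refl_on_def sym_def trans_def strong_homotopy_iff[OF assms])

lemma obj_Grstr: "P \<in> obj Grstr \<longleftrightarrow> strict_Gr_category P"
  by (simp add: Grstr_def)

text \<open>The \<open>fo\<close> and \<open>fm\<close> of a composite depend only on those of the
  factors, and by \<open>strong_homotopy_iff\<close> these decide strong homotopy.\<close>

lemma strong_homotopy_cong: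
  assumes "P \<in> obj Grstr" "Q \<in> obj Grstr" "R \<in> obj Grstr"
    and "(F, F') \<in> strong_homotopy P Q" "(G, G') \<in> strong_homotopy Q R"
  shows "(cmp Grstr P Q R F G, cmp Grstr P Q R F' G') \<in> strong_homotopy P R"
proof -
  have "cmp Grstr P Q R F G \<in> mor Grstr P R" "cmp Grstr P Q R F' G' \<in> mor Grstr P R"
    using assms by (auto simp: obj_Grstr strong_homotopy_iff intro!: category_cmp category_Grstr)
  then show ?thesis
    using assms by (auto simp: strong_homotopy_iff obj_Grstr) (auto simp: Grstr_def Gr_comp_def)
qed

lemma category_HoGrstr: "category HoGrstr"
  unfolding HoGrstr_def
  by (rule category_quotient)
     (auto simp: category_Grstr strong_homotopy_cong equiv_strong_homotopy obj_Grstr)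

lemma cmp_HoGrstr:
  assumes "strict_Gr_category P" "strict_Gr_category Q" "strict_Gr_category R"
    and "F \<in> mor Grstr P Q" "G \<in> mor Grstr Q R"
  shows "cmp HoGrstr P Q R (strong_homotopy P Q `` {F}) (strong_homotopy Q R `` {G}) =
    strong_homotopy P R `` {Gr_comp P Q R F G}"
proof -
  have "Gr_comp P Q R F G = cmp Grstr P Q R F G" by (simp add: Grstr_def)
  then show ?thesis
    unfolding HoGrstr_def
    by (subst quotient_cmp)
       (use assms in \<open>auto simp: category_Grstr strong_homotopy_cong equiv_strong_homotopy obj_Grstr\<close>)
qed

section \<open>Transport along the identification with crossed modules\<close>

text \<open>The inverse of \<open>gr_ident P\<close> under \<open>Gr_comp\<close>. The two
  categories have arrows of different types, so neither functor is literally a morphism of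
  \<open>Grstr\<close>.\<close>

definition gr_ident_inv :: "('o, 'm) smcat \<Rightarrow> ('o, 'm, 'o, 'o \<times> 'm) grfctr" where
  "gr_ident_inv P =
    \<lparr> fo = (\<lambda>x \<in> obj P. x),
      fm = (\<lambda>x y. \<lambda>f \<in> mor P x y. as_element P x y f),
      ften = (\<lambda>x y. if x \<in> obj P \<and> y \<in> obj P
        then idt (gr_of_xmod (xmod_of_gr P)) (tenO P x y) else undefined),
      funt = idt (gr_of_xmod (xmod_of_gr P)) (unt P) \<rparr>"

context strict_Gr
begin

abbreviation G where "G \<equiv> gr_of_xmod C"

lemma xmod_C: "xmod C"
  by unfold_locales (rule crossed_module_xmod_of_gr)

lemma strict_Gr_G: "strict_Gr_category G"
  by (rule xmod.strict_Gr_gr_of_xmod[OF xmod_C])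

lemma G_simps [simp]:
  "obj G = obj P" "tenO G = tenO P" "unt G = unt P" "x \<in> obj P \<Longrightarrow> idt G x = \<one>\<^bsub>B\<^esub>"
  using xmod.gr_simps[OF xmod_C] by simp_all

lemma mor_G: "u \<in> mor G x y \<longleftrightarrow> u \<in> carrier B \<and> y \<in> obj P \<and> x = tenO P (fst u) y"
  using xmod.gr_simps(2)[OF xmod_C] xmod.gr_mor_iff[OF xmod_C, of u x y] by auto

lemma one_G [simp]: "x \<in> obj P \<Longrightarrow> \<one>\<^bsub>B\<^esub> \<in> mor G x x"
  by (simp add: mor_G)

lemma cmp_G: "u \<in> mor G x y \<Longrightarrow> v \<in> mor G y z \<Longrightarrow> cmp G x y z u v = u \<otimes>\<^bsub>B\<^esub> v"
  using xmod.gr_cmp[OF xmod_C] xmod.gr_simps(2)[OF xmod_C] by metis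

lemma tenM_G:
  "u \<in> mor G x y \<Longrightarrow> u' \<in> mor G x' y' \<Longrightarrow> tenM G x y x' y' u u' = u \<otimes>\<^bsub>B\<^esub> xt C y u'"
  using xmod.gr_tenM[OF xmod_C] xmod.gr_simps(2)[OF xmod_C] by metis

lemma of_element_G [simp]:
  "u \<in> mor G x y \<Longrightarrow> m y u \<in> mor P x y" "u \<in> mor G x y \<Longrightarrow> e x y (m y u) = u"
  by (simp_all add: mor_G of_element_mor as_element_of_element)

lemma as_element_G [simp]: "f \<in> mor P x y \<Longrightarrow> e x y f \<in> mor G x y"
  using mor_obj[of f x y] by (simp add: mor_G D.m_assoc)

lemma pair_G: "strict_Gr_pair G P" "strict_Gr_pair P G"
  using gr strict_Gr_G by (simp_all add: strict_Gr_pair_def strict_Gr_def)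

lemma fm_gr_ident: "u \<in> mor G x y \<Longrightarrow> fm (gr_ident P) x y u = m y u"
  by (simp add: gr_ident_def of_element_def)

lemma fo_gr_ident: "x \<in> obj P \<Longrightarrow> fo (gr_ident P) x = x"
  by (simp add: gr_ident_def)

text \<open>The laws hold for \<open>as_element\<close>, the inverse on each hom-set, and are pulled
  back through its injectivity.\<close>

lemma strict_functor_gr_ident: "strict_functor G P (gr_ident P)"
proof -
  interpret GP: strict_Gr_pair G P by (rule pair_G)
  have idt: "m x \<one>\<^bsub>B\<^esub> = idt P x" if "x \<in> obj P" for x
    by (rule as_element_inj[of x x]) (use that in \<open>simp_all add: of_element_mor as_element_of_element\<close>)
  have cmp: "m z (cmp G x y z u v) = cmp P x y z (m y u) (m z v)"
    if "u \<in> mor G x y" "v \<in> mor G y z" for u v x y z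
    by (rule as_element_inj[of x z]) (use that GP.P.cmp_mor[OF that] in \<open>simp_all add: cmp_G\<close>)
  have ten: "m (tenO P y y') (tenM G x y x' y' u u') = tenM P x y x' y' (m y u) (m y' u')"
    if "u \<in> mor G x y" "u' \<in> mor G x' y'" for u u' x y x' y'
    by (rule as_element_inj[of "tenO P x x'" "tenO P y y'"])
       (use that GP.P.tenM_mor[OF that] in \<open>simp_all add: tenM_G\<close>)
  have "is_functor G P (gr_ident P)"
    using idt cmp by (simp add: is_functor_def fm_gr_ident fo_gr_ident)
  moreover have "fm (gr_ident P) (tenO G x x') (tenO G y y') (tenM G x y x' y' f f') =
       tenM P (fo (gr_ident P) x) (fo (gr_ident P) y) (fo (gr_ident P) x') (fo (gr_ident P) y')
         (fm (gr_ident P) x y f) (fm (gr_ident P) x' y' f')"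
    if "f \<in> mor G x y" "f' \<in> mor G x' y'" for x y x' y' f f'
    using that ten GP.P.mor_obj[OF that(1)] GP.P.mor_obj[OF that(2)] GP.P.tenM_mor[OF that]
    by (simp add: fm_gr_ident fo_gr_ident)
  ultimately show ?thesis
    by (simp add: strict_functor_def fo_gr_ident) (simp add: gr_ident_def)
qed

lemma single_gr_ident: "single_Gr_functor G P (gr_ident P)"
proof -
  interpret GP: strict_Gr_pair G P by (rule pair_G)
  show ?thesis
    using strict_functor_gr_ident
    by (intro conjI GP.strict_Gr_functorI; (assumption | auto simp add: gr_ident_def)?)
qed

text \<open>Strictness is \<open>as_element_idt\<close>, \<open>as_element_cmp\<close> and
  \<open>as_element_ten\<close>.\<close>

lemma strict_functor_gr_ident_inv: "strict_functor P G (gr_ident_inv P)"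
  by (auto simp: strict_functor_def is_functor_def gr_ident_inv_def cmp_G tenM_G dest!: mor_obj)

lemma single_gr_ident_inv: "single_Gr_functor P G (gr_ident_inv P)"
proof -
  interpret PG: strict_Gr_pair P G by (rule pair_G)
  show ?thesis
    using strict_functor_gr_ident_inv
    by (intro conjI PG.strict_Gr_functorI; (assumption | auto simp add: gr_ident_inv_def)?)
qed

lemma gr_ident_comp_inv: "Gr_comp G P G (gr_ident P) (gr_ident_inv P) = Gr_id G"
proof -
  let ?H = "Gr_comp G P G (gr_ident P) (gr_ident_inv P)"
  have inv: "fm (gr_ident_inv P) x y f = e x y f" if "f \<in> mor P x y" for x y f
    using that by (simp add: gr_ident_inv_def)
  have o: "x \<in> obj P \<and> y \<in> obj P" if "u \<in> mor G x y" for u x y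
    using that by (auto simp: mor_G)
  have "fo ?H = fo (Gr_id G)"
    by (auto simp: Gr_comp_def Gr_id_def gr_ident_def gr_ident_inv_def fun_eq_iff)
  moreover have "fm ?H x y u = fm (Gr_id G) x y u" for x y u
    by (cases "u \<in> mor G x y")
       (simp_all add: Gr_comp_def Gr_id_def fo_gr_ident fm_gr_ident inv o)
  moreover have "ften ?H x y = ften (Gr_id G) x y" for x y
    by (simp add: Gr_comp_def Gr_id_def fo_gr_ident inv)
       (simp add: gr_ident_def gr_ident_inv_def cmp_G)
  moreover have "funt ?H = funt (Gr_id G)"
    by (simp add: Gr_comp_def Gr_id_def fo_gr_ident inv)
       (simp add: gr_ident_def gr_ident_inv_def cmp_G)
  ultimately show ?thesis by (intro grfctr.equality) (simp_all add: fun_eq_iff)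
qed

lemma gr_ident_inv_comp: "Gr_comp P G P (gr_ident_inv P) (gr_ident P) = Gr_id P"
proof -
  have "fm (gr_ident P) x y (fm (gr_ident_inv P) x y f) = f" if "f \<in> mor P x y" for x y f
    using that by (simp add: gr_ident_inv_def fm_gr_ident of_element_as_element)
  moreover have "fm (gr_ident P) x x \<one>\<^bsub>B\<^esub> = idt P x" if "x \<in> obj P" for x
    using that strict_Gr_pair.fm_idt[OF pair_G(1) strict_functor_gr_ident, of x] by (simp add: gr_ident_def)
  ultimately show ?thesis
    unfolding Gr_comp_def Gr_id_def
    by (intro grfctr.equality)
       (auto simp: fun_eq_iff restrict_def dest: mor_obj,
        auto simp: gr_ident_def gr_ident_inv_def dest: mor_obj)
qed

lemma strict_Gr_isomorphism_gr_ident: "strict_Gr_isomorphism G P (gr_ident P)"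
proof -
  have "bij_betw (fm (gr_ident P) x y) (mor G x y) (mor P x y)" for x y
    by (rule bij_betw_byWitness[where f' = "e x y"]) (auto simp: fm_gr_ident of_element_as_element)
  moreover have "bij_betw (fo (gr_ident P)) (obj G) (obj P)"
    by (rule bij_betw_byWitness[where f' = "\<lambda>x. x"]) (auto simp: gr_ident_def)
  moreover have "is_functor G P (gr_ident P)"
    using strict_functor_gr_ident by (simp add: strict_functor_def)
  ultimately show ?thesis
    using single_gr_ident
    by (simp add: strict_Gr_isomorphism_def bij_functor_def) (simp add: gr_ident_def)
qed

end

text \<open>Preserving and reflecting the relation, \<open>T\<close> maps the class of
  \<open>a\<close> onto the class of \<open>T a\<close>. Taking images is injective because classes
  are subsets of \<open>A\<close>.\<close>

lemma bij_betw_image_quotient: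
  assumes T: "bij_betw T A B" and R: "R \<subseteq> A \<times> A" and S: "S \<subseteq> B \<times> B"
    and RS: "\<And>a b. a \<in> A \<Longrightarrow> b \<in> A \<Longrightarrow> (a, b) \<in> R \<longleftrightarrow> (T a, T b) \<in> S"
  shows "bij_betw (image T) (A // R) (B // S)"
proof -
  have cl: "T ` (R `` {a}) = S `` {T a}" if "a \<in> A" for a
  proof (intro equalityI subsetI)
    fix y assume "y \<in> S `` {T a}"
    moreover from this obtain b where "b \<in> A" "y = T b"
      using S T by (auto simp: bij_betw_def)
    ultimately show "y \<in> T ` (R `` {a})" using RS that by auto
  qed (use R RS that in auto)
  have "inj_on (image T) (A // R)"
  proof (rule inj_onI)
    fix u v assume "u \<in> A // R" "v \<in> A // R" "T ` u = T ` v"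
    moreover from this R have "u \<subseteq> A" "v \<subseteq> A" by (auto elim!: quotientE)
    ultimately show "u = v" using T by (metis bij_betw_def inj_on_image_eq_iff)
  qed
  moreover have "image T ` (A // R) = B // S"
    using T cl by (auto simp: bij_betw_def quotient_def image_UN)
  ultimately show ?thesis by (simp add: bij_betw_def)
qed

lemma mor_HoGrstr: "mor HoGrstr P Q = mor Grstr P Q // strong_homotopy P Q"
  by (simp add: HoGrstr_def quotient_cat_def)

lemma mor_Grstr: "F \<in> mor Grstr P Q \<longleftrightarrow> single_Gr_functor P Q F"
  by (simp add: Grstr_def)

text \<open>Conjugation by the isomorphisms \<open>gr_ident P\<close> and \<open>gr_ident Q\<close>
  is a bijection between single functors that respects strong homotopy, and
  \<open>transport_ident\<close> is its image map on classes.\<close>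

lemma transport_ident_bij:
  fixes P Q :: "('o, 'm) smcat"
  assumes "strict_Gr_category P" "strict_Gr_category Q"
  shows "bij_betw (transport_ident P Q)
    (mor HoGrstr (gr_of_xmod (xmod_of_gr P)) (gr_of_xmod (xmod_of_gr Q))) (mor HoGrstr P Q)"
proof -
  interpret P: strict_Gr P using assms by unfold_locales
  interpret Q: strict_Gr Q using assms by unfold_locales
  note gr = assms P.strict_Gr_G Q.strict_Gr_G
  note triple = strict_Gr_triple.intro[OF strict_Gr_pair.intro strict_Gr_pair.intro,
      OF strict_Gr.intro strict_Gr.intro strict_Gr.intro strict_Gr.intro]
  interpret PPQ: strict_Gr_triple P.G P Q by (rule triple) (use gr in blast)+
  interpret PQQ: strict_Gr_triple P Q.G Q by (rule triple) (use gr in blast)+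
  interpret PGQ: strict_Gr_triple P P.G Q.G by (rule triple) (use gr in blast)+
  interpret GQQ: strict_Gr_triple P.G Q Q.G by (rule triple) (use gr in blast)+
  define T where "T F = Gr_comp P Q.G Q (Gr_comp P P.G Q.G (gr_ident_inv P) F) (gr_ident Q)" for F
  define T' where "T' F = Gr_comp P.G Q Q.G (Gr_comp P.G P Q (gr_ident P) F) (gr_ident_inv Q)" for F
  note I = P.single_gr_ident Q.single_gr_ident P.single_gr_ident_inv Q.single_gr_ident_inv
  have T: "single_Gr_functor P Q (T F)" if "single_Gr_functor P.G Q.G F" for F
    unfolding T_def using PQQ.Gr_comp_closed PGQ.Gr_comp_closed I that by blast
  have T': "single_Gr_functor P.G Q.G (T' F)" if "single_Gr_functor P Q F" for F
    unfolding T'_def using GQQ.Gr_comp_closed PPQ.Gr_comp_closed I that by blast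
  \<comment> \<open>\<open>T F\<close> fills the commuting square that defines
    \<open>transport_ident\<close>.\<close>
  have IT: "Gr_comp P.G P Q (gr_ident P) (T F) = Gr_comp P.G Q.G Q F (gr_ident Q)"
    if F: "single_Gr_functor P.G Q.G F" for F
  proof -
    have PF: "single_Gr_functor P Q.G (Gr_comp P P.G Q.G (gr_ident_inv P) F)"
      using PGQ.Gr_comp_closed I F by blast
    have "Gr_comp P.G P Q (gr_ident P) (T F) =
      Gr_comp P.G Q.G Q (Gr_comp P.G P Q.G (gr_ident P) (Gr_comp P P.G Q.G (gr_ident_inv P) F))
        (gr_ident Q)"
      unfolding T_def by (rule Gr_comp_assoc[symmetric]) (use gr I PF in blast)+
    also have "Gr_comp P.G P Q.G (gr_ident P) (Gr_comp P P.G Q.G (gr_ident_inv P) F) =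
      Gr_comp P.G P.G Q.G (Gr_comp P.G P P.G (gr_ident P) (gr_ident_inv P)) F"
      by (rule Gr_comp_assoc[symmetric]) (use gr I F in blast)+
    also have "\<dots> = F" using PGQ.QR.Gr_id_comp[OF F] P.gr_ident_comp_inv by simp
    finally show ?thesis .
  qed
  have TT': "T (T' F) = F" if F: "single_Gr_functor P Q F" for F
  proof -
    have IF: "single_Gr_functor P.G Q (Gr_comp P.G P Q (gr_ident P) F)"
      using PPQ.Gr_comp_closed I F by blast
    have "T (T' F) = Gr_comp P P.G Q (gr_ident_inv P) (Gr_comp P.G Q.G Q (T' F) (gr_ident Q))"
      unfolding T_def by (rule Gr_comp_assoc) (use gr I T'[OF F] in blast)+
    also have "Gr_comp P.G Q.G Q (T' F) (gr_ident Q) =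
      Gr_comp P.G Q Q (Gr_comp P.G P Q (gr_ident P) F)
        (Gr_comp Q Q.G Q (gr_ident_inv Q) (gr_ident Q))"
      unfolding T'_def by (rule Gr_comp_assoc) (use gr I IF in blast)+
    also have "\<dots> = Gr_comp P.G P Q (gr_ident P) F"
      using PPQ.PR.Gr_comp_id[OF IF] Q.gr_ident_inv_comp by simp
    also have "Gr_comp P P.G Q (gr_ident_inv P) (Gr_comp P.G P Q (gr_ident P) F) =
      Gr_comp P P Q (Gr_comp P P.G P (gr_ident_inv P) (gr_ident P)) F"
      by (rule Gr_comp_assoc[symmetric]) (use gr I F in blast)+
    also have "\<dots> = F" using PPQ.QR.Gr_id_comp[OF F] P.gr_ident_inv_comp by simp
    finally show ?thesis .
  qed
  have T'T: "T' (T F) = F" if F: "single_Gr_functor P.G Q.G F" for F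
  proof -
    have "T' (T F) = Gr_comp P.G Q Q.G (Gr_comp P.G Q.G Q F (gr_ident Q)) (gr_ident_inv Q)"
      using IT[OF F] by (simp add: T'_def)
    also have "\<dots> = Gr_comp P.G Q.G Q.G F (Gr_comp Q.G Q Q.G (gr_ident Q) (gr_ident_inv Q))"
      by (rule Gr_comp_assoc) (use gr I F in blast)+
    also have "\<dots> = F" using PGQ.QR.Gr_comp_id[OF F] Q.gr_ident_comp_inv by simp
    finally show ?thesis .
  qed
  have bij: "bij_betw T (mor Grstr P.G Q.G) (mor Grstr P Q)"
    by (rule bij_betw_byWitness[where f' = T']) (auto simp: mor_Grstr T T' TT' T'T)
  \<comment> \<open>Conjugation in either direction acts on underlying functors alone, so the
    relation is both preserved and reflected.\<close>
  have *: "fo (T F) = fo (T G) \<and> fm (T F) = fm (T G)" if "fo F = fo G" "fm F = fm G" for F G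
    using that by (simp add: T_def Gr_comp_def)
  have **: "fo (T' F) = fo (T' G) \<and> fm (T' F) = fm (T' G)" if "fo F = fo G" "fm F = fm G" for F G
    using that by (simp add: T'_def Gr_comp_def)
  have "bij_betw (image T) (mor HoGrstr P.G Q.G) (mor HoGrstr P Q)"
    unfolding mor_HoGrstr
  proof (rule bij_betw_image_quotient[OF bij])
    fix F G assume FG: "F \<in> mor Grstr P.G Q.G" "G \<in> mor Grstr P.G Q.G"
    then show "(F, G) \<in> strong_homotopy P.G Q.G \<longleftrightarrow> (T F, T G) \<in> strong_homotopy P Q"
      using *[of F G] **[of "T F" "T G"] T'T[of F] T'T[of G] T
      by (auto simp: strong_homotopy_iff gr mor_Grstr)
  qed (auto simp: strong_homotopy_iff gr)
  moreover have "transport_ident P Q \<phi> = T ` \<phi>" if "\<phi> \<in> mor HoGrstr P.G Q.G" for \<phi>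
  proof -
    have \<phi>: "F \<in> \<phi> \<Longrightarrow> single_Gr_functor P.G Q.G F" for F
      using that by (auto simp: mor_HoGrstr strong_homotopy_iff gr mor_Grstr elim!: quotientE)
    \<comment> \<open>Applying \<open>T'\<close> to any filler \<open>F\<close> of the square
      returns \<open>F'\<close>, so the filler is unique.\<close>
    have "F = T F'" if F: "single_Gr_functor P Q F" and F': "single_Gr_functor P.G Q.G F'"
      and eq: "Gr_comp P.G P Q (gr_ident P) F = Gr_comp P.G Q.G Q F' (gr_ident Q)" for F F'
      using TT'[OF F] T'T[OF F'] IT[OF F'] eq by (simp add: T'_def)
    then show ?thesis
      using \<phi> by (auto simp: transport_ident_def mor_Grstr T IT)
  qed
  ultimately show ?thesis
    by (simp cong: bij_betw_cong)
qed

section \<open>Crossed module morphisms and strong homotopy classes\<close>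

text \<open>The Gr-category remembers all data: \<open>B\<close> is the union of the hom-sets into
  1, \<open>d\<close> gives the source of such an arrow, the product is a composite and the action
  is a tensor product with an identity. Equality of the records also needs agreement outside the
  carriers, where everything is undefined.\<close>

lemma gr_of_xmod_inj:
  assumes "crossed_module X" "crossed_module Y" and eq: "gr_of_xmod X = gr_of_xmod Y"
  shows "X = Y"
proof -
  interpret X: xmod X using assms by unfold_locales
  interpret Y: xmod Y using assms by unfold_locales
  have D: "carrier (xD X) = carrier (xD Y)" "mult (xD X) = mult (xD Y)" "one (xD X) = one (xD Y)"
    and m: "gr_mor X = gr_mor Y"
    using X.gr_simps(1-4) Y.gr_simps(1-4) eq by metis+
  have xD: "xD X = xD Y" using D by (intro monoid.equality) auto
  have unit: "b \<in> carrier (xB Z) \<longleftrightarrow> (\<exists>x. b \<in> gr_mor Z x \<one>\<^bsub>xD Z\<^esub>)" if "xmod Z" for b and Z :: "('a, 'b) xmod"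
    using xmod.gr_mor_iff[OF that] that
    by (metis group.is_monoid monoid.one_closed xmod.xm crossed_module_def)
  have B: "carrier (xB X) = carrier (xB Y)"
    using unit[OF X.xmod_axioms] unit[OF Y.xmod_axioms] m xD by auto
  have d: "xd X b = xd Y b" if b: "b \<in> carrier (xB X)" for b
  proof -
    have "b \<in> gr_mor X (xd X b) \<one>\<^bsub>xD X\<^esub>" using b by (simp add: X.gr_mor_iff)
    then have "b \<in> gr_mor Y (xd X b) \<one>\<^bsub>xD Y\<^esub>" using m xD by simp
    then show ?thesis using B b by (simp add: Y.gr_mor_iff)
  qed
  \<comment> \<open>The product is the composite \<open>d(b) d(c) -> d(c) -> 1\<close> of
    \<open>b\<close> and \<open>c\<close>.\<close>
  have "mult (xB X) b c = mult (xB Y) b c" for b c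
  proof (cases "b \<in> carrier (xB X) \<and> c \<in> carrier (xB X)")
    case True
    then have "b \<in> gr_mor X (xd X b \<otimes>\<^bsub>xD X\<^esub> xd X c) (xd X c)" "c \<in> gr_mor X (xd X c) \<one>\<^bsub>xD X\<^esub>"
      by (simp_all add: X.gr_mor_iff)
    then show ?thesis
      using X.gr_cmp[of b _ _ c] Y.gr_cmp[of b _ _ c] m eq by metis
  next
    case False
    then show ?thesis using X.mult_undefined(1) Y.mult_undefined(1) B by metis
  qed
  moreover have "one (xB X) = one (xB Y)"
    using X.gr_simps(5)[of "one (xD X)"] Y.gr_simps(5)[of "one (xD Y)"] eq xD by simp
  ultimately have xB: "xB X = xB Y" using B by (intro monoid.equality) (auto simp: fun_eq_iff)
  have "xd X \<in> extensional (carrier (xB X))" "xd Y \<in> extensional (carrier (xB X))"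
    "xt X \<in> extensional (carrier (xD X))" "xt Y \<in> extensional (carrier (xD X))"
    using X.xm Y.xm xB xD by (simp_all add: crossed_module_def)
  note ext = this
  have xd: "xd X = xd Y"
    using ext(1,2) d by (rule extensionalityI)
  \<comment> \<open>The identity of \<open>y\<close> tensored with \<open>b : d(b) -> 1\<close> has
    the action of \<open>y\<close> on \<open>b\<close> as its element.\<close>
  have "xt X y = xt Y y" if y: "y \<in> carrier (xD X)" for y
  proof (rule extensionalityI)
    show "xt X y \<in> extensional (carrier (xB X))" "xt Y y \<in> extensional (carrier (xB X))"
      using X.t_auto[of y] Y.t_auto[of y] y xB xD by (simp_all add: Bij_def)
    fix b assume b: "b \<in> carrier (xB X)"
    have "\<one>\<^bsub>xB X\<^esub> \<in> gr_mor X y y" "b \<in> gr_mor X (xd X b) \<one>\<^bsub>xD X\<^esub>"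
      using y b by (simp_all add: X.gr_mor_iff)
    then have "\<one>\<^bsub>xB X\<^esub> \<otimes>\<^bsub>xB X\<^esub> xt X y b = \<one>\<^bsub>xB Y\<^esub> \<otimes>\<^bsub>xB Y\<^esub> xt Y y b"
      using X.gr_tenM[of "\<one>\<^bsub>xB X\<^esub>" y y b] Y.gr_tenM[of "\<one>\<^bsub>xB Y\<^esub>" y y b] m eq xB by metis
    then show "xt X y b = xt Y y b"
      using X.t_mem[OF y b] Y.t_mem[of y b] y b xB xD by simp
  qed
  then have "xt X = xt Y" using ext(3,4) extensionalityI by blast
  then show ?thesis using xB xD xd by (intro xmod.equality) auto
qed

text \<open>The value of \<open>\<Phi>\<close> on morphisms, written as in the theorem;
  \<open>functor_class_eq\<close> shows it to be a single strong homotopy class.\<close>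

definition functor_class ::
  "('b, 'd) xmod \<Rightarrow> ('b, 'd) xmod \<Rightarrow> ('b \<Rightarrow> 'b) \<times> ('d \<Rightarrow> 'd) \<Rightarrow> ('d, 'b, 'd, 'b) grfctr set" where
  "functor_class X Y f = {F \<in> mor Grstr (gr_of_xmod X) (gr_of_xmod Y).
     (\<forall>x \<in> obj (gr_of_xmod X). fo F x = snd f x) \<and>
     (\<forall>x \<in> obj (gr_of_xmod X). \<forall>y \<in> obj (gr_of_xmod X).
      \<forall>b \<in> mor (gr_of_xmod X) x y. fm F x y b = fst f b)}"

text \<open>The representative with trivial constraints, that is, with
  \<open>\<gamma> = 1\<close>.\<close>

definition functor_of_xmod_morphism ::
  "('b, 'd) xmod \<Rightarrow> ('c, 'e) xmod \<Rightarrow> ('b \<Rightarrow> 'c) \<times> ('d \<Rightarrow> 'e) \<Rightarrow> ('d, 'b, 'e, 'c) grfctr" where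
  "functor_of_xmod_morphism X Y f =
    \<lparr> fo = snd f,
      fm = (\<lambda>x y. \<lambda>b \<in> gr_mor X x y. fst f b),
      ften = (\<lambda>x y. if x \<in> carrier (xD X) \<and> y \<in> carrier (xD X) then \<one>\<^bsub>xB Y\<^esub> else undefined),
      funt = \<one>\<^bsub>xB Y\<^esub> \<rparr>"

text \<open>The component \<open>f1\<close> is read off from arrows into 1, because every
  \<open>b\<close> is an arrow from \<open>d b\<close> to 1.\<close>

definition xmod_morphism_of_functor ::
  "('b, 'd) xmod \<Rightarrow> ('d, 'b, 'e, 'c) grfctr \<Rightarrow> ('b \<Rightarrow> 'c) \<times> ('d \<Rightarrow> 'e)" where
  "xmod_morphism_of_functor X F =
    (\<lambda>b \<in> carrier (xB X). fm F (xd X b) \<one>\<^bsub>xD X\<^esub> b, fo F)"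

locale xmod_pair = X: xmod X + Y: xmod Y
  for X :: "('b, 'd) xmod" and Y :: "('c, 'e) xmod"
begin

sublocale G: strict_Gr_pair X.G Y.G ..

text \<open>Compatibility with \<open>d\<close> puts the images into the right hom-sets,
  multiplicativity of \<open>f1\<close> gives functoriality, and equivariance gives preservation of
  tensor products.\<close>

lemma single_functor_of_xmod_morphism:
  assumes f: "xmod_morphism X Y f"
  shows "single_Gr_functor X.G Y.G (functor_of_xmod_morphism X Y f)"
proof -
  let ?F = "functor_of_xmod_morphism X Y f"
  obtain f1 f0 where ff: "f = (f1, f0)" by (cases f)
  have h: "f1 \<in> hom (xB X) (xB Y)" "f0 \<in> hom (xD X) (xD Y)"
    and e: "f0 \<in> extensional (carrier (xD X))"
    and d [simp]: "\<And>b. b \<in> carrier (xB X) \<Longrightarrow> f0 (xd X b) = xd Y (f1 b)"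
    and t [simp]: "\<And>x b. x \<in> carrier (xD X) \<Longrightarrow> b \<in> carrier (xB X) \<Longrightarrow>
      f1 (xt X x b) = xt Y (f0 x) (f1 b)"
    using f by (simp_all add: xmod_morphism_def ff)
  interpret f1: group_hom "xB X" "xB Y" f1 by unfold_locales (rule h)
  interpret f0: group_hom "xD X" "xD Y" f0 by unfold_locales (rule h)
  have fm: "fm ?F x y b = f1 b" if "b \<in> gr_mor X x y" for x y b
    using that by (simp add: functor_of_xmod_morphism_def ff)
  have fo: "fo ?F = f0" by (simp add: functor_of_xmod_morphism_def ff)
  have mor: "f1 b \<in> gr_mor Y (f0 x) (f0 y)" if "b \<in> gr_mor X x y" for x y b
    using that by (auto simp: X.gr_mor_iff Y.gr_mor_iff)
  have B: "b \<in> carrier (xB X)" if "b \<in> gr_mor X x y" for x y b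
    using that by (simp add: X.gr_mor_iff)
  have D: "y \<in> carrier (xD X)" if "b \<in> gr_mor X x y" for x y b
    using that by (simp add: X.gr_mor_iff)
  have "is_functor X.G Y.G ?F"
    using mor B by (simp add: is_functor_def fo fm)
  moreover have "fm ?F (x \<otimes>\<^bsub>xD X\<^esub> x') (y \<otimes>\<^bsub>xD X\<^esub> y') (tenM X.G x y x' y' b b') =
     tenM Y.G (f0 x) (f0 y) (f0 x') (f0 y') (fm ?F x y b) (fm ?F x' y' b')"
    if "b \<in> gr_mor X x y" "b' \<in> gr_mor X x' y'" for x y x' y' b b'
    using that mor[OF that(1)] mor[OF that(2)] B[OF that(1)] B[OF that(2)] D[OF that(1)]
    by (simp add: fm)
  moreover have "f0 x = undefined" if "x \<notin> carrier (xD X)" for x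
    using e that by (simp add: extensional_def)
  moreover have "fm ?F x y b = undefined" if "b \<notin> gr_mor X x y" for x y b
    using that by (simp add: functor_of_xmod_morphism_def)
  ultimately have "strict_functor X.G Y.G ?F"
    by (simp add: strict_functor_def fo)
  then show ?thesis
    by (intro conjI G.strict_Gr_functorI; (assumption | auto simp: functor_of_xmod_morphism_def ff)?)
qed

lemma xmod_morphism_of_functor:
  assumes F: "single_Gr_functor X.G Y.G F"
  shows "xmod_morphism X Y (xmod_morphism_of_functor X F)"
    and "b \<in> gr_mor X x y \<Longrightarrow> fm F x y b = fst (xmod_morphism_of_functor X F) b"
proof -
  note strict_of_single = G.strict_of_single[OF F]
  define f1 where "f1 = (\<lambda>b \<in> carrier (xB X). fm F (xd X b) \<one>\<^bsub>xD X\<^esub> b)"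
  note [simp] = G.fo_obj[OF strict_of_single, simplified] G.fo_ten[OF strict_of_single, simplified]
    G.fo_unt[OF strict_of_single, simplified]
  have [simp]: "fm F x x \<one>\<^bsub>xB X\<^esub> = \<one>\<^bsub>xB Y\<^esub>" if "x \<in> carrier (xD X)" for x
    using G.fm_idt[OF strict_of_single, of x] that by simp
  have mor: "fm F x y b \<in> gr_mor Y (fo F x) (fo F y)" if "b \<in> gr_mor X x y" for x y b
    using G.fm_mor[OF strict_of_single, of b x y] that by simp
  have ten: "fm F (x \<otimes>\<^bsub>xD X\<^esub> x') (y \<otimes>\<^bsub>xD X\<^esub> y') (b \<otimes>\<^bsub>xB X\<^esub> xt X y b') =
      fm F x y b \<otimes>\<^bsub>xB Y\<^esub> xt Y (fo F y) (fm F x' y' b')"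
    if "b \<in> gr_mor X x y" "b' \<in> gr_mor X x' y'" for x y x' y' b b'
    using G.fm_ten[OF strict_of_single, of b x y b' x' y' "x \<otimes>\<^bsub>xD X\<^esub> x'" "y \<otimes>\<^bsub>xD X\<^esub> y'"] that mor
    by simp
  have unit: "b \<in> gr_mor X (xd X b) \<one>\<^bsub>xD X\<^esub>" if "b \<in> carrier (xB X)" for b
    using that by (simp add: X.gr_mor_iff)
  have f1: "f1 b \<in> carrier (xB Y)" "fo F (xd X b) = xd Y (f1 b)" if "b \<in> carrier (xB X)" for b
    using mor[OF unit[OF that]] that by (auto simp: f1_def Y.gr_mor_iff)
  \<comment> \<open>An arrow \<open>b : x -> y\<close> is \<open>b : d(b) -> 1\<close> tensored with
    the identity of \<open>y\<close>, which \<open>F\<close> preserves; hence the value does not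
    depend on the ends.\<close>
  have fm: "fm F x y b = f1 b" if b: "b \<in> gr_mor X x y" for x y b
  proof -
    have o: "b \<in> carrier (xB X)" "y \<in> carrier (xD X)" "x = xd X b \<otimes>\<^bsub>xD X\<^esub> y"
      using b by (auto simp: X.gr_mor_iff)
    then have "fm F x y b = f1 b \<otimes>\<^bsub>xB Y\<^esub> xt Y \<one>\<^bsub>xD Y\<^esub> \<one>\<^bsub>xB Y\<^esub>"
      using ten[OF unit[OF o(1)] X.gr_idt_mor[OF o(2)]] by (simp add: f1_def)
    then show ?thesis using f1(1)[OF o(1)] by simp
  qed
  \<comment> \<open>For arrows into 1 the tensor product is the product of \<open>B\<close>, since 1
    acts trivially.\<close>
  have "f1 (b \<otimes>\<^bsub>xB X\<^esub> c) = f1 b \<otimes>\<^bsub>xB Y\<^esub> f1 c" if [simp]: "b \<in> carrier (xB X)" "c \<in> carrier (xB X)" for b c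
    using ten[OF unit unit, of b c] f1 by (simp add: f1_def)
  then have "f1 \<in> hom (xB X) (xB Y)" using f1 by (auto simp: hom_def)
  moreover have "fo F \<in> hom (xD X) (xD Y)" by (auto simp: hom_def)
  moreover have "fo F \<in> extensional (carrier (xD X))"
    using G.single_undefined(1)[OF F] by (simp add: extensional_def)
  \<comment> \<open>Strictness is applied to the identity of \<open>x\<close> tensored with
    \<open>b\<close>, an arrow \<open>x d(b) -> x\<close> whose element is the action of
    \<open>x\<close> on \<open>b\<close>.\<close>
  moreover have "f1 (xt X x b) = xt Y (fo F x) (f1 b)"
    if [simp]: "x \<in> carrier (xD X)" "b \<in> carrier (xB X)" for x b
  proof -
    have m: "xt X x b \<in> gr_mor X (x \<otimes>\<^bsub>xD X\<^esub> xd X b) x"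
      by (simp add: X.gr_mor_iff X.D.m_assoc)
    have "fm F (x \<otimes>\<^bsub>xD X\<^esub> xd X b) x (xt X x b) = xt Y (fo F x) (f1 b)"
      using ten[OF X.gr_idt_mor[of x] unit[of b]] f1(1)[of b] by (simp add: f1_def)
    then show ?thesis using fm[OF m] by simp
  qed
  ultimately show "xmod_morphism X Y (xmod_morphism_of_functor X F)"
    using f1(2) by (simp add: xmod_morphism_def xmod_morphism_of_functor_def flip: f1_def)
      (simp add: f1_def)
  show "fm F x y b = fst (xmod_morphism_of_functor X F) b" if "b \<in> gr_mor X x y"
    using fm[OF that] by (simp add: xmod_morphism_of_functor_def f1_def)
qed

end

section \<open>Bijectivity of \<open>\<Phi>\<close> on hom-sets\<close>

context
  fixes X Y :: "('b, 'd) xmod"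
  assumes X: "crossed_module X" and Y: "crossed_module Y"
begin

interpretation xmod_pair X Y
  using X Y by unfold_locales

text \<open>Functors are undefined outside their domains, so two of them that agree with
  \<open>f\<close> have equal \<open>fo\<close> and \<open>fm\<close>, which is strong homotopy by
  \<open>strong_homotopy_iff\<close>.\<close>

lemma functor_class_eq:
  assumes F: "F \<in> functor_class X Y f"
  shows "functor_class X Y f = strong_homotopy (gr_of_xmod X) (gr_of_xmod Y) `` {F}"
proof -
  have "fo F = fo H \<and> fm F = fm H \<longleftrightarrow> H \<in> functor_class X Y f"
    if H: "H \<in> mor Grstr X.G Y.G" for H
  proof -
    have "F \<in> mor Grstr X.G Y.G" using F by (simp add: functor_class_def)
    then have F': "single_Gr_functor X.G Y.G F" and H': "single_Gr_functor X.G Y.G H"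
      using H by (simp_all add: mor_Grstr)
    have o: "b \<in> gr_mor X x y \<Longrightarrow> x \<in> carrier (xD X) \<and> y \<in> carrier (xD X)" for b x y
      by (auto simp: X.gr_mor_iff)
    show ?thesis
    proof
      assume "fo F = fo H \<and> fm F = fm H"
      then show "H \<in> functor_class X Y f" using F H by (simp add: functor_class_def)
    next
      assume Hc: "H \<in> functor_class X Y f"
      have "fo F x = fo H x" for x
        using F Hc G.single_undefined(1)[OF F', of x] G.single_undefined(1)[OF H', of x]
        by (cases "x \<in> carrier (xD X)") (simp_all add: functor_class_def)
      moreover have "fm F x y b = fm H x y b" for x y b
        using F Hc o[of b x y] G.single_undefined(2)[OF F', of b x y] G.single_undefined(2)[OF H', of b x y]
        by (cases "b \<in> gr_mor X x y") (simp_all add: functor_class_def)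
      ultimately show "fo F = fo H \<and> fm F = fm H" by blast
    qed
  qed
  then show ?thesis
    using F by (auto simp: strong_homotopy_iff X.strict_Gr_gr_of_xmod Y.strict_Gr_gr_of_xmod)
      (auto simp: functor_class_def)
qed

lemma functor_of_xmod_morphism_class:
  assumes f: "xmod_morphism X Y f"
  shows "functor_of_xmod_morphism X Y f \<in> functor_class X Y f"
  using single_functor_of_xmod_morphism[OF f]
  by (simp add: functor_class_def mor_Grstr) (simp add: functor_of_xmod_morphism_def)

text \<open>For injectivity, the functor built from \<open>f\<close> lies in the class of
  \<open>g\<close>, so \<open>f\<close> and \<open>g\<close> have the same values. For surjectivity,
  any member of a class yields the morphism it comes from.\<close>

lemma functor_class_bij:
  "bij_betw (functor_class X Y) (mor Cross X Y) (mor HoGrstr (gr_of_xmod X) (gr_of_xmod Y))"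
proof (rule bij_betwI')
  fix f g assume "f \<in> mor Cross X Y" "g \<in> mor Cross X Y"
  then have f: "xmod_morphism X Y f" and g: "xmod_morphism X Y g" by (simp_all add: Cross_def)
  have "f = g" if "functor_class X Y f = functor_class X Y g"
  proof -
    have mem: "functor_of_xmod_morphism X Y f \<in> functor_class X Y g"
      using functor_of_xmod_morphism_class[OF f] that by simp
    have e: "fst h \<in> extensional (carrier (xB X))" "snd h \<in> extensional (carrier (xD X))"
      if "xmod_morphism X Y h" for h
      using that by (auto simp: xmod_morphism_def)
    have "snd f x = snd g x" if "x \<in> carrier (xD X)" for x
      using mem that by (simp add: functor_class_def functor_of_xmod_morphism_def)
    then have "snd f = snd g" using e f g extensionalityI by metis
    moreover have "fst f b = fst g b" if b: "b \<in> carrier (xB X)" for b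
    proof -
      have "b \<in> gr_mor X (xd X b) \<one>\<^bsub>xD X\<^esub>" using b by (simp add: X.gr_mor_iff)
      moreover from this have "fm (functor_of_xmod_morphism X Y f) (xd X b) \<one>\<^bsub>xD X\<^esub> b = fst g b"
        using mem b by (simp add: functor_class_def)
      ultimately show ?thesis by (simp add: functor_of_xmod_morphism_def)
    qed
    then have "fst f = fst g" using e f g extensionalityI by metis
    ultimately show ?thesis by (simp add: prod_eq_iff)
  qed
  then show "functor_class X Y f = functor_class X Y g \<longleftrightarrow> f = g" by blast
next
  fix f assume "f \<in> mor Cross X Y"
  then have f: "xmod_morphism X Y f" by (simp add: Cross_def)
  note c = functor_of_xmod_morphism_class[OF f]
  show "functor_class X Y f \<in> mor HoGrstr X.G Y.G"
    unfolding mor_HoGrstr functor_class_eq[OF c]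
    using c by (intro quotientI) (simp add: functor_class_def)
next
  fix \<phi> assume "\<phi> \<in> mor HoGrstr X.G Y.G"
  then obtain F where F: "F \<in> mor Grstr X.G Y.G" "\<phi> = strong_homotopy X.G Y.G `` {F}"
    by (auto simp: mor_HoGrstr elim: quotientE)
  then have s: "single_Gr_functor X.G Y.G F" by (simp add: mor_Grstr)
  let ?f = "xmod_morphism_of_functor X F"
  have "F \<in> functor_class X Y ?f"
    using F xmod_morphism_of_functor(2)[OF s]
    by (simp add: functor_class_def) (simp add: xmod_morphism_of_functor_def)
  then have "\<phi> = functor_class X Y ?f" using functor_class_eq F by simp
  then show "\<exists>f\<in>mor Cross X Y. \<phi> = functor_class X Y f"
    using xmod_morphism_of_functor(1)[OF s] by (intro bexI[of _ ?f]) (simp_all add: Cross_def)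
qed

end

section \<open>\<open>Cross\<close> as a category and functoriality of \<open>\<Phi>\<close>\<close>

lemma category_Cross: "category (Cross :: (('b, 'd) xmod, ('b \<Rightarrow> 'b) \<times> ('d \<Rightarrow> 'd)) cat)"
proof -
  have idm: "xmod_morphism X X (\<lambda>b\<in>carrier (xB X). b, \<lambda>x\<in>carrier (xD X). x)"
    if "crossed_module X" for X :: "('b, 'd) xmod"
  proof -
    interpret xmod X using that by unfold_locales
    show ?thesis by (auto simp: xmod_morphism_def hom_def)
  qed
  have cmpm: "xmod_morphism X Z
      (compose (carrier (xB X)) (fst g) (fst f), compose (carrier (xD X)) (snd g) (snd f))"
    if "crossed_module X" "crossed_module Y" "xmod_morphism X Y f" "xmod_morphism Y Z g"
    for X Y Z :: "('b, 'd) xmod" and f g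
  proof -
    interpret X: xmod X using that by unfold_locales
    show ?thesis
      using that(3,4) by (auto simp: xmod_morphism_def hom_def Pi_iff compose_def)
  qed
  have unit: "compose (carrier (xB X)) (fst f) (\<lambda>b\<in>carrier (xB X). b) = fst f"
    "compose (carrier (xD X)) (snd f) (\<lambda>b\<in>carrier (xD X). b) = snd f"
    "compose (carrier (xB X)) (\<lambda>b\<in>carrier (xB Y). b) (fst f) = fst f"
    "compose (carrier (xD X)) (\<lambda>b\<in>carrier (xD Y). b) (snd f) = snd f"
    if "xmod_morphism X Y f" for X Y :: "('b, 'd) xmod" and f
    using that by (auto simp: xmod_morphism_def hom_def intro!: compose_Id Id_compose)
  have assoc: "compose (carrier (xB X)) h (compose (carrier (xB X)) g (fst f)) =
      compose (carrier (xB X)) (compose (carrier (xB Y)) h g) (fst f)"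
    "compose (carrier (xD X)) h' (compose (carrier (xD X)) g' (snd f)) =
      compose (carrier (xD X)) (compose (carrier (xD Y)) h' g') (snd f)"
    if "xmod_morphism X Y f" for X Y :: "('b, 'd) xmod" and f g h g' h'
    using that by (auto simp: xmod_morphism_def hom_def intro!: compose_assoc)
  show ?thesis
    by (auto simp: category_def Cross_def prod_eq_iff unit assoc[symmetric] intro: idm cmpm
        simp del: split_paired_All)
qed

lemma category_full_subcat: "category C \<Longrightarrow> category (full_subcat C S)"
  unfolding category_def full_subcat_def by simp

lemma functor_class_idt:
  assumes "crossed_module X"
  shows "functor_class X X (idt Cross X) = idt HoGrstr (gr_of_xmod X)"
proof -
  interpret xmod X using assms by unfold_locales
  have "Gr_id G \<in> functor_class X X (idt Cross X)"
    using single_Gr_functor_id[OF strict_Gr_gr_of_xmod]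
    by (auto simp: functor_class_def mor_Grstr Cross_def) (auto simp: Gr_id_def gr_mor_iff)
  from functor_class_eq[OF assms assms this] show ?thesis
    by (simp add: HoGrstr_def quotient_cat_def Grstr_def)
qed

text \<open>Computed on representatives: the composite of the functors built from \<open>f\<close>
  and \<open>g\<close> lies in the class of the composite morphism, and a class is determined by any
  member.\<close>

lemma functor_class_cmp:
  assumes X: "crossed_module X" "crossed_module Y" "crossed_module Z"
    and f: "xmod_morphism X Y f" and g: "xmod_morphism Y Z g"
  shows "functor_class X Z (cmp Cross X Y Z f g) =
    cmp HoGrstr (gr_of_xmod X) (gr_of_xmod Y) (gr_of_xmod Z)
      (functor_class X Y f) (functor_class Y Z g)"
proof -
  interpret XY: xmod_pair X Y using X by unfold_locales
  interpret YZ: xmod_pair Y Z using X by unfold_locales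
  let ?F = "functor_of_xmod_morphism X Y f" and ?H = "functor_of_xmod_morphism Y Z g"
  note F = functor_of_xmod_morphism_class[OF X(1,2) f]
  note H = functor_of_xmod_morphism_class[OF X(2,3) g]
  note gr = XY.X.strict_Gr_gr_of_xmod XY.Y.strict_Gr_gr_of_xmod YZ.Y.strict_Gr_gr_of_xmod
  have m: "?F \<in> mor Grstr (gr_of_xmod X) (gr_of_xmod Y)" "?H \<in> mor Grstr (gr_of_xmod Y) (gr_of_xmod Z)"
    using F H by (simp_all add: functor_class_def)
  let ?K = "Gr_comp (gr_of_xmod X) (gr_of_xmod Y) (gr_of_xmod Z) ?F ?H"
  have "?K \<in> mor Grstr (gr_of_xmod X) (gr_of_xmod Z)"
    using category_cmp[OF category_Grstr _ _ _ m] gr by (simp add: obj_Grstr) (simp add: Grstr_def)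
  moreover have "fst f b \<in> gr_mor Y (snd f x) (snd f y)" if "b \<in> gr_mor X x y" for b x y
    using that f by (auto simp: xmod_morphism_def hom_def XY.X.gr_mor_iff XY.Y.gr_mor_iff)
  ultimately have "?K \<in> functor_class X Z (cmp Cross X Y Z f g)"
    unfolding functor_class_def
    by (auto simp: Cross_def Gr_comp_def functor_of_xmod_morphism_def compose_def XY.X.gr_mor_iff)
  then show ?thesis
    using cmp_HoGrstr[OF gr m] functor_class_eq[OF X(1,2) F] functor_class_eq[OF X(2,3) H]
      functor_class_eq[OF X(1,3)] by simp
qed

text \<open>The identification of strict Gr-categories with crossed modules is spelled out.
  \<open>\<Phi>\<close> is bijective onto the full subcategory of the \<open>gr_of_xmod X\<close>;
  the other conjuncts show that each strict Gr-category is strictly isomorphic to one of this form,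
  with corresponding hom-sets in \<open>HoGrstr\<close>, and that each crossed module is recovered
  up to isomorphism.\<close>

theorem theorem6:
  shows "(\<exists>\<Phi> :: (('b, 'd) xmod, ('b \<Rightarrow> 'b) \<times> ('d \<Rightarrow> 'd),
                   ('d, 'b) smcat, ('d, 'b, 'd, 'b) grfctr set) fctr.
            isomorphism_of_categories Cross
              (full_subcat HoGrstr (gr_of_xmod ` {X. crossed_module X})) \<Phi> \<and>
            (\<forall>X. crossed_module X \<longrightarrow> fo \<Phi> X = gr_of_xmod X) \<and>
            (\<forall>X Y f1 f0. crossed_module X \<longrightarrow> crossed_module Y \<longrightarrow> xmod_morphism X Y (f1, f0) \<longrightarrow>
               fm \<Phi> X Y (f1, f0) =
                 {F \<in> mor Grstr (gr_of_xmod X) (gr_of_xmod Y).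
                    (\<forall>x \<in> obj (gr_of_xmod X). fo F x = f0 x) \<and>
                    (\<forall>x \<in> obj (gr_of_xmod X). \<forall>y \<in> obj (gr_of_xmod X).
                     \<forall>b \<in> mor (gr_of_xmod X) x y. fm F x y b = f1 b)})) \<and>
         category (HoGrstr :: (('o, 'm) smcat, ('o, 'm, 'o, 'm) grfctr set) cat) \<and>
         (\<forall>P :: ('o, 'm) smcat. strict_Gr_category P \<longrightarrow>
            crossed_module (xmod_of_gr P) \<and>
            strict_Gr_isomorphism (gr_of_xmod (xmod_of_gr P)) P (gr_ident P)) \<and>
         (\<forall>P Q :: ('o, 'm) smcat. strict_Gr_category P \<longrightarrow> strict_Gr_category Q \<longrightarrow>
            bij_betw (transport_ident P Q)
              (mor HoGrstr (gr_of_xmod (xmod_of_gr P)) (gr_of_xmod (xmod_of_gr Q)))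
              (mor HoGrstr P Q)) \<and>
         (\<forall>X :: ('b, 'd) xmod. crossed_module X \<longrightarrow>
            xmod_isomorphism X (xmod_of_gr (gr_of_xmod X)) (xmod_ident X))"
proof (intro conjI allI impI)
  let ?S = "gr_of_xmod ` {X :: ('b, 'd) xmod. crossed_module X}"
  let ?H = "full_subcat HoGrstr ?S"
  let ?\<Phi> = "\<lparr>fo = gr_of_xmod, fm = functor_class\<rparr> :: (('b, 'd) xmod, ('b \<Rightarrow> 'b) \<times> ('d \<Rightarrow> 'd),
                   ('d, 'b) smcat, ('d, 'b, 'd, 'b) grfctr set) fctr"
  have H: "mor ?H = mor HoGrstr" "idt ?H = idt HoGrstr" "cmp ?H = cmp HoGrstr"
    by (simp_all add: full_subcat_def)
  have "strict_Gr_category (gr_of_xmod X)" if "crossed_module X" for X :: "('b, 'd) xmod"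
    using xmod.strict_Gr_gr_of_xmod[of X] that by (simp add: xmod_def)
  then have obj: "obj ?H = ?S"
    by (auto simp: full_subcat_def HoGrstr_def quotient_cat_def obj_Grstr)
  have Cross: "X \<in> obj Cross \<longleftrightarrow> crossed_module X" "f \<in> mor Cross X Y \<longleftrightarrow> xmod_morphism X Y f"
    for X Y :: "('b, 'd) xmod" and f
    by (simp_all add: Cross_def)
  have "functor_class X Y f \<in> mor HoGrstr (gr_of_xmod X) (gr_of_xmod Y)"
    if "crossed_module X" "crossed_module Y" "xmod_morphism X Y f" for X Y :: "('b, 'd) xmod" and f
    using bij_betw_apply[OF functor_class_bij[OF that(1,2)]] that(3) by (simp add: Cross)
  then have "is_functor Cross ?H ?\<Phi>"
    by (auto simp: is_functor_def H obj Cross functor_class_idt functor_class_cmp)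
  moreover have "bij_betw gr_of_xmod (obj Cross) ?S"
    by (auto simp: bij_betw_def inj_on_def Cross intro: gr_of_xmod_inj)
  ultimately have "bij_functor Cross ?H ?\<Phi>"
    by (simp add: bij_functor_def H obj Cross functor_class_bij)
  then have "isomorphism_of_categories Cross ?H ?\<Phi>"
    by (simp add: isomorphism_of_categories_def category_Cross category_full_subcat category_HoGrstr)
  then show "\<exists>\<Phi> :: (('b, 'd) xmod, ('b \<Rightarrow> 'b) \<times> ('d \<Rightarrow> 'd),
                   ('d, 'b) smcat, ('d, 'b, 'd, 'b) grfctr set) fctr.
            isomorphism_of_categories Cross ?H \<Phi> \<and>
            (\<forall>X. crossed_module X \<longrightarrow> fo \<Phi> X = gr_of_xmod X) \<and>
            (\<forall>X Y f1 f0. crossed_module X \<longrightarrow> crossed_module Y \<longrightarrow> xmod_morphism X Y (f1, f0) \<longrightarrow>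
               fm \<Phi> X Y (f1, f0) =
                 {F \<in> mor Grstr (gr_of_xmod X) (gr_of_xmod Y).
                    (\<forall>x \<in> obj (gr_of_xmod X). fo F x = f0 x) \<and>
                    (\<forall>x \<in> obj (gr_of_xmod X). \<forall>y \<in> obj (gr_of_xmod X).
                     \<forall>b \<in> mor (gr_of_xmod X) x y. fm F x y b = f1 b)})"
    by (intro exI[of _ ?\<Phi>]) (simp add: functor_class_def)
next
  fix P :: "('o, 'm) smcat" assume "strict_Gr_category P"
  then interpret strict_Gr P by unfold_locales
  show "crossed_module (xmod_of_gr P)" by (rule crossed_module_xmod_of_gr)
  show "strict_Gr_isomorphism (gr_of_xmod (xmod_of_gr P)) P (gr_ident P)"
    by (rule strict_Gr_isomorphism_gr_ident)
qed (auto intro: category_HoGrstr transport_ident_bij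
    xmod.xmod_isomorphism_ident[OF xmod.intro])

end
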